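(* Let $q$ be a $Q$-function such that $\int_{T_0}^s q(x,t)\,dt<\infty$ for each $s\in\,]T_0,T_1[$ and $x\in\mathbf{X}$. Then the transition function $\bar P$ is the minimal function in $\mathcal{P}$ among functions $P\in\mathcal{P}$ satisfying the following two properties: (i) for all $t\in\,]T_0,T_1[$, $x\in\mathbf{X}$, and $B\in\mathfrak{B}(\mathbf{X})$, $\lim_{u\to t-}P(u,x;t,B)=\mathbf{I}\{x\in B\}$, and the function $u\mapsto P(u,x;t,B)$ is absolutely continuous in $u\in[T_0,t[$; (ii) for all $t\in\,]T_0,T_1[$, $x\in\mathbf{X}$, and $B\in\mathfrak{B}(\mathbf{X})$, Kolmogorov's backward equation $$\frac{\partial}{\partial u}P(u,x;t,B)=q(x,u)P(u,x;t,B)-\int_{\mathbf{X}}P(u,y;t,B)\,q^+(x,u,dy)$$ holds for almost every $u\in[T_0,t[$. In addition, if the transition function $\bar P$ is regular (that is, $\bar P(u,x;t,\mathbf{X})=1$ for all $u\in[T_0,T_1[$, $t\in\,]u,T_1[$, $x\in\mathbf{X}$), then $\bar P$ is the unique function in $\mathcal{P}$ that satisfies properties (i) and (ii), is a measure on $(\mathbf{X},\mathfrak{B}(\mathbf{X}))$ for all $t\in\,]T_0,T_1[$, $u\in[T_0,t[$, $x\in\mathbf{X}$, and takes values in $[0,1]$.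
   Context: Intervals: $]a,b[$ and $[a,b[$ denote open and half-open intervals. $(\mathbf{X},\mathfrak{B}(\mathbf{X}))$ is a standard Borel space; $0\le T_0<T_1\le\infty$; measurability means Borel measurability. $Q$-function: a function $q(x,t,B)$, $x\in\mathbf{X}$, $t\in[T_0,T_1[$, $B\in\mathfrak{B}(\mathbf{X})$, such that (a) for all $x,t$, $q(x,t,\cdot)$ is a (finite) signed measure with $q(x,t,\mathbf{X})\le 0$ and $0\le q(x,t,B\setminus\{x\})<\infty$ for all $B$; (b) for each $B$, $q(x,t,B)$ is measurable in $(x,t)$. Standing assumption: $q$ is conservative, i.e. $q(x,t,\mathbf{X})=0$ for all $x,t$. Put $q(x,t):=-q(x,t,\{x\})$ and $q^+(x,t,B):=q(x,t,B\setminus\{x\})$ (the paper writes $q(x,t,dy\setminus\{x\})$ for $q^+(x,t,dy)$). The function $\bar P$ (which under the hypothesis of the claim is known to be a transition function, i.e. $[0,1]$-valued, a measure in $B$, measurable in $(u,x,t)$, and satisfying the Chapman–Kolmogorov equation): for $x\in\mathbf{X}$, $u\in[T_0,T_1[$, $t\in\,]u,T_1[$, $B\in\mathfrak{B}(\mathbf{X})$, $\bar P^{(0)}(u,x;t,B):=\mathbf{I}\{x\in B\}e^{-\int_u^t q(x,s)ds}$, $\bar P^{(n)}(u,x;t,B):=\int_u^t\int_{\mathbf{X}}e^{-\int_u^w q(x,\theta)d\theta}\,\bar P^{(n-1)}(w,y;t,B)\,q^+(x,w,dy)\,dw$ for $n\ge1$, and $\bar P:=\sum_{n=0}^\infty\bar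 P^{(n)}$. $\mathcal{P}$ is the family of all real-valued non-negative functions $P(u,x;t,B)$, defined for $t\in\,]T_0,T_1[$, $u\in[T_0,t[$, $x\in\mathbf{X}$, $B\in\mathfrak{B}(\mathbf{X})$, which are measurable in $(u,x)\in[T_0,t[\,\times\mathbf{X}$ for all $t\in\,]T_0,T_1[$ and $B\in\mathfrak{B}(\mathbf{X})$. A function $f$ is minimal in a family $\mathcal{A}$ of functions on a common set $E$ if $f\in\mathcal{A}$ and $f\le g$ pointwise on $E$ for every $g\in\mathcal{A}$; "the minimal function satisfying given properties" means the minimal element of the subfamily of functions with those properties (in particular it has them). A differential equation "holds" at a point if the derivative exists there and the equality holds between finite numbers (in particular the integral is finite). *)

theory Defs
  imports "HOL-Analysis.Analysis"
begin

section \<open>Spaces, signed measures, absolute continuity\<close>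

text \<open>Only \<^term>\<open>space X\<close> and \<^term>\<open>sets X\<close> matter here; the measure carried by \<^term>\<open>X\<close> is irrelevant.\<close>

definition standard_borel :: "'a measure \<Rightarrow> bool" where
  "standard_borel X \<longleftrightarrow>
     (\<exists>T. completely_metrizable_space T \<and> second_countable T \<and> topspace T = space X \<and>
          sets X = sigma_sets (topspace T) {U. openin T U})"

definition signed_measure :: "'a measure \<Rightarrow> ('a set \<Rightarrow> real) \<Rightarrow> bool" where
  "signed_measure X \<mu> \<longleftrightarrow>
     \<mu> {} = 0 \<and>
     (\<forall>A :: nat \<Rightarrow> 'a set. range A \<subseteq> sets X \<longrightarrow> disjoint_family A \<longrightarrow>
        (\<lambda>i. \<mu> (A i)) sums \<mu> (\<Union>i. A i))"

text \<open>The usual epsilon-delta notion for a real function on an interval \<^term>\<open>I\<close>, which need not be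
  compact. It is unrelated to the library's \<^const>\<open>absolutely_continuous\<close>, a relation between measures.\<close>

definition absolutely_continuous_on :: "real set \<Rightarrow> (real \<Rightarrow> real) \<Rightarrow> bool" where
  "absolutely_continuous_on I f \<longleftrightarrow>
     (\<forall>\<epsilon>>0. \<exists>\<delta>>0. \<forall>(n::nat) a b.
        (\<forall>i<n. a i \<le> b i \<and> {a i..b i} \<subseteq> I) \<longrightarrow>
        disjoint_family_on (\<lambda>i. {a i<..<b i}) {..<n} \<longrightarrow>
        (\<Sum>i<n. b i - a i) < \<delta> \<longrightarrow>
        (\<Sum>i<n. \<bar>f (b i) - f (a i)\<bar>) < \<epsilon>)"

section \<open>Q-functions\<close>

definition time_set :: "real \<Rightarrow> ereal \<Rightarrow> real set" where
  "time_set T0 T1 = {t. T0 \<le> t \<and> ereal t < T1}"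

definition Q_function ::
  "'a measure \<Rightarrow> real \<Rightarrow> ereal \<Rightarrow> ('a \<Rightarrow> real \<Rightarrow> 'a set \<Rightarrow> real) \<Rightarrow> bool" where
  "Q_function X T0 T1 q \<longleftrightarrow>
     (\<forall>x\<in>space X. \<forall>t\<in>time_set T0 T1.
        signed_measure X (q x t) \<and> q x t (space X) \<le> 0 \<and>
        (\<forall>B\<in>sets X. 0 \<le> q x t (B - {x}))) \<and>
     (\<forall>B\<in>sets X. (\<lambda>(x, t). q x t B) \<in>
        borel_measurable (X \<Otimes>\<^sub>M restrict_space borel (time_set T0 T1)))"

definition conservative ::
  "'a measure \<Rightarrow> real \<Rightarrow> ereal \<Rightarrow> ('a \<Rightarrow> real \<Rightarrow> 'a set \<Rightarrow> real) \<Rightarrow> bool" where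
  "conservative X T0 T1 q \<longleftrightarrow> (\<forall>x\<in>space X. \<forall>t\<in>time_set T0 T1. q x t (space X) = 0)"

definition rate :: "('a \<Rightarrow> real \<Rightarrow> 'a set \<Rightarrow> real) \<Rightarrow> 'a \<Rightarrow> real \<Rightarrow> real" where
  "rate q x t = - q x t {x}"

text \<open>The measure \<open>q\<^sup>+(x, t, dy)\<close>. For a Q-function, \<open>x \<in> space X\<close> and \<open>t \<in> time_set T0 T1\<close> the set function
  is a finite measure on \<^term>\<open>sets X\<close>, so \<^const>\<open>measure_of\<close> does not fall back to the null measure.\<close>

definition qplus ::
  "'a measure \<Rightarrow> ('a \<Rightarrow> real \<Rightarrow> 'a set \<Rightarrow> real) \<Rightarrow> 'a \<Rightarrow> real \<Rightarrow> 'a measure" where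
  "qplus X q x t = measure_of (space X) (sets X) (\<lambda>B. ennreal (q x t (B - {x})))"

section \<open>The function \<open>Pbar\<close>\<close>

text \<open>All terms are nonnegative, so the iterated integrals and the series are taken in the extended
  nonnegative reals.\<close>

primrec Pbar_term ::
  "'a measure \<Rightarrow> ('a \<Rightarrow> real \<Rightarrow> 'a set \<Rightarrow> real) \<Rightarrow> nat \<Rightarrow> real \<Rightarrow> 'a \<Rightarrow> real \<Rightarrow> 'a set \<Rightarrow> ennreal"
where
  "Pbar_term X q 0 u x t B =
     indicator B x * ennreal (exp (- (LBINT s:{u..t}. rate q x s)))"
| "Pbar_term X q (Suc n) u x t B =
     (\<integral>\<^sup>+w\<in>{u..<t}.
        (\<integral>\<^sup>+y. ennreal (exp (- (LBINT \<theta>:{u..w}. rate q x \<theta>))) * Pbar_term X q n w y t B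
           \<partial>qplus X q x w) \<partial>lborel)"

text \<open>For a conservative Q-function with locally integrable rates the series is bounded by 1,
  so \<^const>\<open>enn2real\<close> only changes the type.\<close>

definition Pbar ::
  "'a measure \<Rightarrow> ('a \<Rightarrow> real \<Rightarrow> 'a set \<Rightarrow> real) \<Rightarrow> real \<times> 'a \<times> real \<times> 'a set \<Rightarrow> real" where
  "Pbar X q = (\<lambda>(u, x, t, B). enn2real (\<Sum>n. Pbar_term X q n u x t B))"

section \<open>The family of functions and its properties\<close>

text \<open>A function \<open>P(u, x; t, B)\<close> is a HOL function on quadruples of which only the values on the
  following set are relevant.\<close>

definition domP :: "'a measure \<Rightarrow> real \<Rightarrow> ereal \<Rightarrow> (real \<times> 'a \<times> real \<times> 'a set) set" where
  "domP X T0 T1 =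
     {(u, x, t, B). T0 < t \<and> ereal t < T1 \<and> T0 \<le> u \<and> u < t \<and> x \<in> space X \<and> B \<in> sets X}"

definition familyP ::
  "'a measure \<Rightarrow> real \<Rightarrow> ereal \<Rightarrow> (real \<times> 'a \<times> real \<times> 'a set \<Rightarrow> real) set" where
  "familyP X T0 T1 =
     {P. (\<forall>e\<in>domP X T0 T1. 0 \<le> P e) \<and>
         (\<forall>t B. T0 < t \<longrightarrow> ereal t < T1 \<longrightarrow> B \<in> sets X \<longrightarrow>
            (\<lambda>(u, x). P (u, x, t, B)) \<in> borel_measurable (restrict_space borel {T0..<t} \<Otimes>\<^sub>M X))}"

definition boundary_property ::
  "'a measure \<Rightarrow> real \<Rightarrow> ereal \<Rightarrow> (real \<times> 'a \<times> real \<times> 'a set \<Rightarrow> real) \<Rightarrow> bool" where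
  "boundary_property X T0 T1 P \<longleftrightarrow>
     (\<forall>t x B. T0 < t \<longrightarrow> ereal t < T1 \<longrightarrow> x \<in> space X \<longrightarrow> B \<in> sets X \<longrightarrow>
        ((\<lambda>u. P (u, x, t, B)) \<longlongrightarrow> indicator B x) (at_left t) \<and>
        absolutely_continuous_on {T0..<t} (\<lambda>u. P (u, x, t, B)))"

definition backward_equation ::
  "'a measure \<Rightarrow> real \<Rightarrow> ereal \<Rightarrow> ('a \<Rightarrow> real \<Rightarrow> 'a set \<Rightarrow> real) \<Rightarrow>
   (real \<times> 'a \<times> real \<times> 'a set \<Rightarrow> real) \<Rightarrow> bool" where
  "backward_equation X T0 T1 q P \<longleftrightarrow>
     (\<forall>t x B. T0 < t \<longrightarrow> ereal t < T1 \<longrightarrow> x \<in> space X \<longrightarrow> B \<in> sets X \<longrightarrow>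
        (AE u in lborel. u \<in> {T0..<t} \<longrightarrow>
           integrable (qplus X q x u) (\<lambda>y. P (u, y, t, B)) \<and>
           ((\<lambda>v. P (v, x, t, B)) has_real_derivative
              rate q x u * P (u, x, t, B) - (\<integral>y. P (u, y, t, B) \<partial>qplus X q x u))
             (at u within {T0..<t})))"

definition minimal_on :: "'e set \<Rightarrow> ('e \<Rightarrow> real) set \<Rightarrow> ('e \<Rightarrow> real) \<Rightarrow> bool" where
  "minimal_on E \<A> f \<longleftrightarrow> f \<in> \<A> \<and> (\<forall>g\<in>\<A>. \<forall>e\<in>E. f e \<le> g e)"

text \<open>A function on \<^term>\<open>E\<close> is determined by its values on \<^term>\<open>E\<close>, hence uniqueness is stated
  up to the values elsewhere.\<close>

definition unique_on :: "'e set \<Rightarrow> ('e \<Rightarrow> real) set \<Rightarrow> ('e \<Rightarrow> real) \<Rightarrow> bool" where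
  "unique_on E \<A> f \<longleftrightarrow> f \<in> \<A> \<and> (\<forall>g\<in>\<A>. \<forall>e\<in>E. g e = f e)"

definition regular ::
  "'a measure \<Rightarrow> real \<Rightarrow> ereal \<Rightarrow> (real \<times> 'a \<times> real \<times> 'a set \<Rightarrow> real) \<Rightarrow> bool" where
  "regular X T0 T1 P \<longleftrightarrow>
     (\<forall>u t x. u \<in> time_set T0 T1 \<longrightarrow> u < t \<longrightarrow> ereal t < T1 \<longrightarrow> x \<in> space X \<longrightarrow>
        P (u, x, t, space X) = 1)"

definition measure_valued ::
  "'a measure \<Rightarrow> real \<Rightarrow> ereal \<Rightarrow> (real \<times> 'a \<times> real \<times> 'a set \<Rightarrow> real) \<Rightarrow> bool" where
  "measure_valued X T0 T1 P \<longleftrightarrow>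
     (\<forall>t u x. T0 < t \<longrightarrow> ereal t < T1 \<longrightarrow> T0 \<le> u \<longrightarrow> u < t \<longrightarrow> x \<in> space X \<longrightarrow>
        measure_space (space X) (sets X) (\<lambda>B. ennreal (P (u, x, t, B))))"

end

theory Submission
  imports Defs "HOL-Probability.Giry_Monad"
begin

text \<open>Multiplied by the integrating factor \<open>exp (- \<integral> q)\<close>, the backward equation says that the derivative in \<open>u\<close> is
  minus the damped inflow \<open>\<integral> P(u, y; t, B) q\<^sup>+(x, u, dy)\<close>. For absolutely continuous functions it is therefore
  equivalent to the integral equation whose Picard iterates, started at 0, are the partial sums of the series \<open>Pbar\<close>.
  Since the integral operator is monotone, every nonnegative solution dominates these iterates and hence
  \<open>Pbar\<close>. If \<open>Pbar\<close> has total mass 1, comparing a solution with \<open>Pbar\<close> on \<open>B\<close> and on its complement leaves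
  no room for strict inequality.\<close>

section \<open>Absolutely continuous functions\<close>

text \<open>The rate is integrable only on \<open>[T0, s]\<close> with \<open>s\<close> below
  \<open>T1\<close>, and a competing solution is absolutely continuous only on
  \<open>[T0, t[\<close>. The terminal time \<open>t\<close> is therefore fixed throughout: the
  kernel is switched off outside \<open>[T0, t]\<close>, which leaves the values with terminal time
  \<open>t\<close> unchanged, and \<open>t\<close> itself is reached by a limit from the left, where
  the boundary condition supplies the indicator of \<open>B\<close>. The exponent is a difference
  \<open>G u x - G w x\<close> of values of one cumulative rate, so the integral equation separates
  into a factor in \<open>u\<close> and an indefinite integral whose integrand is free of
  \<open>u\<close>; Lebesgue differentiation then yields the derivative. The converse needs the
  fundamental theorem for absolutely continuous functions, and the gauge integral suits it because
  integrability of the derivative is part of the conclusion there. A separate obstacle is the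
  measurability of the jump measure in \<open>(x, t)\<close>: it evaluates \<open>q\<close> at
  \<open>B - {x}\<close>, a set moving with \<open>x\<close>, whereas \<open>q\<close> is measurable
  for fixed sets. A countable family of sets that separates points resolves this.\<close>

lemma absolutely_continuous_on_subset:
  "absolutely_continuous_on J f \<Longrightarrow> I \<subseteq> J \<Longrightarrow> absolutely_continuous_on I f"
  unfolding absolutely_continuous_on_def by (meson subset_trans)

text \<open>The inner part of the epsilon-delta condition for one fixed pair. Naming it lets a proof
  obtain \<open>\<delta>\<close> once and then apply it to an interval family of its own
  choice.\<close>

definition increments_below :: "real set \<Rightarrow> (real \<Rightarrow> real) \<Rightarrow> real \<Rightarrow> real \<Rightarrow> bool" where
  "increments_below I f \<delta> \<epsilon> \<longleftrightarrow>
     (\<forall>(n::nat) a b.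
        (\<forall>i<n. a i \<le> b i \<and> {a i..b i} \<subseteq> I) \<longrightarrow>
        disjoint_family_on (\<lambda>i. {a i<..<b i}) {..<n} \<longrightarrow>
        (\<Sum>i<n. b i - a i) < \<delta> \<longrightarrow>
        (\<Sum>i<n. \<bar>f (b i) - f (a i)\<bar>) < \<epsilon>)"

lemma absolutely_continuous_on_iff_increments_below:
  "absolutely_continuous_on I f \<longleftrightarrow> (\<forall>\<epsilon>>0. \<exists>\<delta>>0. increments_below I f \<delta> \<epsilon>)"
  unfolding absolutely_continuous_on_def increments_below_def ..

lemma increments_belowI:
  assumes "\<And>(n::nat) a b. (\<And>i. i < n \<Longrightarrow> a i \<le> b i) \<Longrightarrow> (\<And>i. i < n \<Longrightarrow> {a i..b i} \<subseteq> I) \<Longrightarrow>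
     disjoint_family_on (\<lambda>i. {a i<..<b i}) {..<n} \<Longrightarrow>
     (\<Sum>i<n. b i - a i) < \<delta> \<Longrightarrow> (\<Sum>i<n. \<bar>f (b i) - f (a i)\<bar>) < \<epsilon>"
  shows "increments_below I f \<delta> \<epsilon>"
  unfolding increments_below_def using assms by simp

lemma increments_belowD:
  fixes n :: nat
  assumes "increments_below I f \<delta> \<epsilon>" "\<And>i. i < n \<Longrightarrow> a i \<le> b i" "\<And>i. i < n \<Longrightarrow> {a i..b i} \<subseteq> I"
    "disjoint_family_on (\<lambda>i. {a i<..<b i}) {..<n}" "(\<Sum>i<n. b i - a i) < \<delta>"
  shows "(\<Sum>i<n. \<bar>f (b i) - f (a i)\<bar>) < \<epsilon>"
  using assms unfolding increments_below_def by simp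

text \<open>The increment sums of \<open>h\<close> are controlled by those of \<open>f\<close> and
  \<open>g\<close> over the same intervals. Congruence, Lipschitz composition and products are all
  instances of this estimate.\<close>

lemma absolutely_continuous_on_dominated:
  assumes f: "absolutely_continuous_on I f" and g: "absolutely_continuous_on I g"
    and A: "A \<ge> 0" "C \<ge> 0"
    and dom: "\<And>x y. x \<in> I \<Longrightarrow> y \<in> I \<Longrightarrow> \<bar>h x - h y\<bar> \<le> A * \<bar>f x - f y\<bar> + C * \<bar>g x - g y\<bar>"
  shows "absolutely_continuous_on I h"
  unfolding absolutely_continuous_on_iff_increments_below
proof (intro allI impI)
  fix \<epsilon> :: real assume \<epsilon>: "0 < \<epsilon>"
  \<comment> \<open>The summand 1 keeps the denominator positive when \<open>A = C = 0\<close> and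
    makes the final bound strict.\<close>
  define \<eta> where "\<eta> = \<epsilon> / (A + C + 1)"
  have \<eta>: "\<eta> > 0" unfolding \<eta>_def using \<epsilon> A by (intro divide_pos_pos) auto
  obtain d1 where d1: "d1 > 0" "increments_below I f d1 \<eta>"
    using f \<eta> unfolding absolutely_continuous_on_iff_increments_below by blast
  obtain d2 where d2: "d2 > 0" "increments_below I g d2 \<eta>"
    using g \<eta> unfolding absolutely_continuous_on_iff_increments_below by blast
  have "increments_below I h (min d1 d2) \<epsilon>"
  proof (rule increments_belowI)
    fix n :: nat and a b :: "nat \<Rightarrow> real"
    assume ab: "\<And>i. i < n \<Longrightarrow> a i \<le> b i" "\<And>i. i < n \<Longrightarrow> {a i..b i} \<subseteq> I"
      "disjoint_family_on (\<lambda>i. {a i<..<b i}) {..<n}" "(\<Sum>i<n. b i - a i) < min d1 d2"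
    have "a i \<in> I" "b i \<in> I" if "i < n" for i using ab(1,2)[OF that] by auto
    then have "(\<Sum>i<n. \<bar>h (b i) - h (a i)\<bar>) \<le> (\<Sum>i<n. A * \<bar>f (b i) - f (a i)\<bar> + C * \<bar>g (b i) - g (a i)\<bar>)"
      by (intro sum_mono dom) auto
    also have "\<dots> = A * (\<Sum>i<n. \<bar>f (b i) - f (a i)\<bar>) + C * (\<Sum>i<n. \<bar>g (b i) - g (a i)\<bar>)"
      by (simp add: sum.distrib sum_distrib_left)
    also have "\<dots> \<le> A * \<eta> + C * \<eta>"
      using increments_belowD[OF d1(2) ab(1-3)] increments_belowD[OF d2(2) ab(1-3)] ab(4) A
      by (intro add_mono mult_left_mono) auto
    also have "\<dots> < (A + C + 1) * \<eta>" using \<eta> by (simp add: algebra_simps)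
    also have "\<dots> = \<epsilon>" unfolding \<eta>_def using A by simp
    finally show "(\<Sum>i<n. \<bar>h (b i) - h (a i)\<bar>) < \<epsilon>" .
  qed
  then show "\<exists>\<delta>>0. increments_below I h \<delta> \<epsilon>" using d1 d2 by (intro exI[of _ "min d1 d2"]) auto
qed

lemma absolutely_continuous_on_cong:
  assumes "absolutely_continuous_on I f" "\<And>x. x \<in> I \<Longrightarrow> f x = g x"
  shows "absolutely_continuous_on I g"
  by (rule absolutely_continuous_on_dominated[OF assms(1,1), of 1 0]) (use assms(2) in auto)

lemma absolutely_continuous_on_lipschitz_compose:
  assumes f: "absolutely_continuous_on I f" and "C-lipschitz_on (f ` I) g"
  shows "absolutely_continuous_on I (\<lambda>x. g (f x))"
proof (rule absolutely_continuous_on_dominated[OF f f, of C 0])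
  show "C \<ge> 0" using assms(2) by (rule lipschitz_on_nonneg)
  show "\<bar>g (f x) - g (f y)\<bar> \<le> C * \<bar>f x - f y\<bar> + 0 * \<bar>f x - f y\<bar>" if "x \<in> I" "y \<in> I" for x y
    using lipschitz_onD[OF assms(2), of "f x" "f y"] that by (simp add: dist_real_def)
qed simp

text \<open>The increment of a product splits as
  \<open>(f x - f y) * g x + f y * (g x - g y)\<close>. Boundedness is a hypothesis because absolute
  continuity on an unbounded interval such as \<open>{..t}\<close> does not imply it.\<close>

lemma absolutely_continuous_on_mult:
  assumes f: "absolutely_continuous_on I f" and g: "absolutely_continuous_on I g"
    and bdd: "bounded (f ` I)" "bounded (g ` I)"
  shows "absolutely_continuous_on I (\<lambda>x. f x * g x)"
proof -
  obtain A where A: "A > 0" "\<And>x. x \<in> I \<Longrightarrow> \<bar>f x\<bar> \<le> A"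
    using bdd(1) unfolding bounded_pos by auto
  obtain C where C: "C > 0" "\<And>x. x \<in> I \<Longrightarrow> \<bar>g x\<bar> \<le> C"
    using bdd(2) unfolding bounded_pos by auto
  show ?thesis
  proof (rule absolutely_continuous_on_dominated[OF f g, of C A])
    fix x y assume "x \<in> I" "y \<in> I"
    have "\<bar>f x * g x - f y * g y\<bar> = \<bar>(f x - f y) * g x + f y * (g x - g y)\<bar>" by (simp add: algebra_simps)
    also have "\<dots> \<le> \<bar>f x - f y\<bar> * \<bar>g x\<bar> + \<bar>f y\<bar> * \<bar>g x - g y\<bar>"
      by (rule order_trans[OF abs_triangle_ineq]) (simp add: abs_mult)
    also have "\<dots> \<le> \<bar>f x - f y\<bar> * C + A * \<bar>g x - g y\<bar>"
      using A C \<open>x \<in> I\<close> \<open>y \<in> I\<close> by (intro add_mono mult_left_mono mult_right_mono) auto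
    finally show "\<bar>f x * g x - f y * g y\<bar> \<le> C * \<bar>f x - f y\<bar> + A * \<bar>g x - g y\<bar>" by (simp add: mult.commute)
  qed (use A C in auto)
qed

lemma absolutely_continuous_on_imp_continuous_on:
  assumes f: "absolutely_continuous_on I f" and I: "is_interval I"
  shows "continuous_on I f"
proof (rule continuous_onI)
  fix x \<epsilon> :: real assume x: "x \<in> I" and "0 < \<epsilon>"
  obtain \<delta> where "\<delta> > 0" and \<delta>: "increments_below I f \<delta> \<epsilon>"
    using f \<open>0 < \<epsilon>\<close> unfolding absolutely_continuous_on_iff_increments_below by blast
  have "\<bar>f v - f u\<bar> < \<epsilon>" if "u \<in> I" "v \<in> I" "u \<le> v" "v - u < \<delta>" for u v
  proof -
    have "{u..v} \<subseteq> I" using mem_is_interval_1_I[OF I that(1,2)] by auto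
    then show ?thesis
      using increments_belowD[OF \<delta>, of 1 "\<lambda>_. u" "\<lambda>_. v"] that by (simp add: disjoint_family_on_def)
  qed
  note * = this
  have "dist (f x') (f x) \<le> \<epsilon>" if "x' \<in> I" "dist x' x < \<delta>" for x'
    using *[of x x'] *[of x' x] that x by (cases "x \<le> x'") (auto simp: dist_real_def abs_if split: if_splits)
  then show "\<exists>d>0. \<forall>x'\<in>I. dist x' x < d \<longrightarrow> dist (f x') (f x) \<le> \<epsilon>"
    using \<open>\<delta> > 0\<close> by blast
qed

text \<open>The tangent line inequality \<open>1 + (x - y) \<le> exp (x - y)\<close>, scaled by
  \<open>exp y\<close>, bounds the increment; an upper bound of the set is enough since
  \<open>exp\<close> flattens to the left.\<close>

lemma lipschitz_on_exp:
  fixes S :: "real set"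
  assumes "\<And>x. x \<in> S \<Longrightarrow> x \<le> c"
  shows "(exp c)-lipschitz_on S exp"
proof (rule lipschitz_onI)
  have *: "\<bar>exp x - exp y\<bar> \<le> exp c * \<bar>x - y\<bar>" if "x \<le> y" "y \<le> c" for x y :: real
  proof -
    have "exp y * (1 + (x - y)) \<le> exp y * exp (x - y)"
      by (intro mult_left_mono exp_ge_add_one_self) simp
    then have "exp y - exp x \<le> exp y * (y - x)"
      by (simp add: exp_diff algebra_simps)
    also have "\<dots> \<le> exp c * (y - x)" using that by (intro mult_right_mono) auto
    finally show ?thesis using that by simp
  qed
  show "dist (exp x) (exp y) \<le> exp c * dist x y" if "x \<in> S" "y \<in> S" for x y
    using *[of x y] *[of y x] assms that by (cases "x \<le> y") (auto simp: dist_real_def abs_minus_commute)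
qed simp

section \<open>The fundamental theorem of calculus via the gauge integral\<close>

text \<open>Translates between the indexed interval families of absolute continuity and the tagged
  cells of a gauge division. The open interiors of the cells are disjoint and lie in
  \<open>U\<close>, so their total length is at most the measure of \<open>U\<close>.\<close>

lemma increments_below_tagged_sum:
  assumes \<delta>: "increments_below I f \<delta> \<epsilon>"
    and p: "p tagged_division_of {a..b}" "p' \<subseteq> p" "{a..b} \<subseteq> I"
    and U: "\<And>x K. (x, K) \<in> p' \<Longrightarrow> K \<subseteq> U" "U \<in> lmeasurable" "measure lebesgue U < \<delta>"
  shows "(\<Sum>(x, K)\<in>p'. \<bar>f (Sup K) - f (Inf K)\<bar>) < \<epsilon>"
proof -
  have fin: "finite p'" using p(1,2) by (meson finite_subset tagged_division_of_finite)
  obtain k where k: "bij_betw k {..<card p'} p'"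
    using ex_bij_betw_nat_finite[OF fin] by (auto simp: atLeast0LessThan)
  \<comment> \<open>A cell contains its tag, hence is a nonempty interval, and \<open>Inf\<close>
    and \<open>Sup\<close> recover its endpoints.\<close>
  have K: "\<exists>u v. K = {u..v} \<and> u \<le> v \<and> K \<subseteq> {a..b}" if "(x, K) \<in> p'" for x K
  proof -
    have "(x, K) \<in> p" using that p by auto
    from tagged_division_ofD(2,3)[OF p(1) this] tagged_division_ofD(4)[OF p(1) this] show ?thesis by force
  qed
  define l where "l i = Inf (snd (k i))" for i
  define r where "r i = Sup (snd (k i))" for i
  have kp: "k i \<in> p'" if "i < card p'" for i using k that by (auto simp: bij_betw_def)
  have sk: "snd (k i) = {l i..r i} \<and> l i \<le> r i \<and> {l i..r i} \<subseteq> {a..b}" if i: "i < card p'" for i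
  proof -
    obtain u v where "snd (k i) = {u..v}" "u \<le> v" "{u..v} \<subseteq> {a..b}"
      using K[of "fst (k i)" "snd (k i)"] kp[OF i] by auto
    then show ?thesis unfolding l_def r_def by simp
  qed
  have disj: "disjoint_family_on (\<lambda>i. {l i<..<r i}) {..<card p'}"
    unfolding disjoint_family_on_def
  proof (intro ballI impI)
    fix i j assume ij: "i \<in> {..<card p'}" "j \<in> {..<card p'}" "i \<noteq> j"
    then have "k i \<noteq> k j" using k by (auto simp: bij_betw_def inj_on_def)
    moreover have "(fst (k i), snd (k i)) \<in> p" "(fst (k j), snd (k j)) \<in> p" using kp ij p(2) by auto
    ultimately have "interior (snd (k i)) \<inter> interior (snd (k j)) = {}"
      by (intro tagged_division_ofD(5)[OF p(1)]) (auto simp: prod_eq_iff)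
    then show "{l i<..<r i} \<inter> {l j<..<r j} = {}" using sk ij by (simp add: interior_atLeastAtMost_real)
  qed
  have "(\<Sum>i<card p'. r i - l i) = (\<Sum>i<card p'. measure lebesgue {l i<..<r i})"
    using sk by (intro sum.cong) auto
  also have "\<dots> = measure lebesgue (\<Union>i<card p'. {l i<..<r i})"
    by (rule measure_finite_Union[symmetric]) (use disj sk in auto)
  also have "\<dots> \<le> measure lebesgue U"
  proof (rule measure_mono_fmeasurable[OF _ _ U(2)])
    show "(\<Union>i<card p'. {l i<..<r i}) \<subseteq> U"
    proof
      fix z assume "z \<in> (\<Union>i<card p'. {l i<..<r i})"
      then obtain i where i: "i < card p'" "z \<in> {l i<..<r i}" by auto
      then have "z \<in> snd (k i)" using sk by auto
      then show "z \<in> U" using U(1)[of "fst (k i)" "snd (k i)"] kp[OF i(1)] by auto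
    qed
  qed auto
  finally have small: "(\<Sum>i<card p'. r i - l i) < \<delta>" using U(3) by simp
  have "(\<Sum>i<card p'. \<bar>f (r i) - f (l i)\<bar>) < \<epsilon>"
    by (rule increments_belowD[OF \<delta> _ _ disj small]) (use sk p(3) in blast)+
  also have "(\<Sum>i<card p'. \<bar>f (r i) - f (l i)\<bar>) = (\<Sum>(x, K)\<in>p'. \<bar>f (Sup K) - f (Inf K)\<bar>)"
    using sum.reindex_bij_betw[OF k, of "\<lambda>(x, K). \<bar>f (Sup K) - f (Inf K)\<bar>"]
    by (simp add: l_def r_def case_prod_beta)
  finally show ?thesis .
qed

text \<open>The derivative is gauge integrable: at the exceptional points, the gauge is chosen inside an open set
  of small measure, where absolute continuity makes the increments of \<open>f\<close> negligible.\<close>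

theorem absolutely_continuous_on_FTC:
  fixes f g :: "real \<Rightarrow> real"
  assumes ac: "absolutely_continuous_on {a..b} f" and ab: "a \<le> b"
    and ae: "AE u in lborel. u \<in> {a..b} \<longrightarrow> (f has_real_derivative g u) (at u within {a..b})"
  shows "(g has_integral (f b - f a)) {a..b}"
proof -
  obtain N where N: "N \<in> null_sets lborel"
    "{u \<in> space lborel. \<not> (u \<in> {a..b} \<longrightarrow> (f has_real_derivative g u) (at u within {a..b}))} \<subseteq> N"
    using ae by (auto elim!: AE_E simp: null_sets_def)
  have negl: "negligible N" using N(1) by (simp add: negligible_iff_null_sets null_sets_completionI)
  have der: "(f has_real_derivative g u) (at u within {a..b})" if "u \<in> {a..b}" "u \<notin> N" for u
    using N(2) that by auto
  \<comment> \<open>With value 0 on \<open>N\<close>, Riemann terms tagged in \<open>N\<close>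
    vanish and only increments of \<open>f\<close> remain there; the change is undone at the end
    because \<open>N\<close> is negligible.\<close>
  define g0 where "g0 x = (if x \<in> N then 0 else g x)" for x
  have "(g0 has_integral (f b - f a)) {a..b}"
    unfolding has_integral_real
  proof (intro allI impI)
    fix e :: real assume e: "e > 0"
    \<comment> \<open>The cells tagged outside \<open>N\<close> contribute at most
      \<open>e1 * (b - a)\<close>, which is below \<open>e / 2\<close>; the summand 1 covers
      \<open>a = b\<close>.\<close>
    define e1 where "e1 = e / (2 * (b - a + 1))"
    have e1: "e1 > 0" unfolding e1_def using e ab by simp
    obtain \<delta> where "\<delta> > 0" and \<delta>: "increments_below {a..b} f \<delta> (e / 2)"
      using ac half_gt_zero[OF e] unfolding absolutely_continuous_on_iff_increments_below by blast
    obtain U where U: "open U" "N \<subseteq> U" "U \<in> lmeasurable" "measure lebesgue U < \<delta>"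
    proof -
      have "N \<in> sets lebesgue" using negl by (rule negligible_imp_sets)
      from sets_lebesgue_outer_open[OF this \<open>\<delta> > 0\<close>] obtain U where U: "open U" "N \<subseteq> U"
        "U - N \<in> lmeasurable" "emeasure lebesgue (U - N) < ennreal \<delta>" by auto
      have UU: "U = (U - N) \<union> N" using U(2) by auto
      have Nl: "N \<in> lmeasurable" using negl by (rule negligible_imp_measurable)
      have Ul: "U \<in> lmeasurable" using U(3) Nl UU by (metis fmeasurable.Un)
      have "measure lebesgue U \<le> measure lebesgue (U - N) + measure lebesgue N"
        using UU U(3) Nl by (metis fmeasurableD measure_Un_le)
      also have "measure lebesgue N = 0" using negl by (rule negligible_imp_measure0)
      also have "measure lebesgue (U - N) < \<delta>"
        using U(3,4) \<open>\<delta> > 0\<close> by (simp add: emeasure_eq_measure2 ennreal_less_iff)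
      finally show ?thesis using that U Ul by auto
    qed
    have "\<exists>d>0. (x \<in> N \<longrightarrow> ball x d \<subseteq> U) \<and>
        (x \<in> {a..b} - N \<longrightarrow> (\<forall>y\<in>{a..b}. norm (y-x) < d \<longrightarrow> norm (f y - f x - (y-x) * g x) \<le> e1 * norm (y-x)))" for x
    proof (cases "x \<in> N")
      case True
      then show ?thesis using U(1,2) openE by blast
    next
      case False
      show ?thesis
      proof (cases "x \<in> {a..b}")
        case True
        then have "(f has_derivative (\<lambda>h. h * g x)) (at x within {a..b})"
          using der[OF True False] by (simp add: has_field_derivative_def mult_commute_abs)
        then show ?thesis using e1 False unfolding has_derivative_within_alt by auto
      qed (use False in \<open>auto intro: exI[of _ 1]\<close>)
    qed
    then obtain d where d: "\<And>x. d x > 0" "\<And>x. x \<in> N \<Longrightarrow> ball x (d x) \<subseteq> U"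
      "\<And>x y. x \<in> {a..b} - N \<Longrightarrow> y \<in> {a..b} \<Longrightarrow> norm (y-x) < d x \<Longrightarrow> norm (f y - f x - (y-x) * g x) \<le> e1 * norm (y-x)"
      by metis
    show "\<exists>\<gamma>. gauge \<gamma> \<and> (\<forall>p. p tagged_division_of {a..b} \<and> \<gamma> fine p \<longrightarrow>
        norm ((\<Sum>(x, K)\<in>p. measure lborel K *\<^sub>R g0 x) - (f b - f a)) < e)"
    proof (rule exI[of _ "\<lambda>x. ball x (d x)"], intro conjI allI impI)
      show "gauge (\<lambda>x. ball x (d x))" using d(1) gauge_ball_dependent by blast
      fix p assume "p tagged_division_of {a..b} \<and> (\<lambda>x. ball x (d x)) fine p"
      then have p: "p tagged_division_of {a..b}" and fine: "(\<lambda>x. ball x (d x)) fine p" by auto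
      have fin: "finite p" using p by blast
      define p1 where "p1 = {(x, K) \<in> p. x \<in> N}"
      have p1: "p1 \<subseteq> p" by (auto simp: p1_def)
      let ?err = "\<lambda>(x, K). measure lborel K *\<^sub>R g0 x - (f (Sup K) - f (Inf K))"
      have 1: "norm (\<Sum>z\<in>p1. ?err z) < e / 2"
      proof -
        have "norm (\<Sum>z\<in>p1. ?err z) \<le> (\<Sum>(x, K)\<in>p1. \<bar>f (Sup K) - f (Inf K)\<bar>)"
          by (rule sum_norm_le) (auto simp: p1_def g0_def)
        also have "\<dots> < e / 2"
        proof (rule increments_below_tagged_sum[OF \<delta> p p1 order_refl _ U(3,4)])
          show "K \<subseteq> U" if "(x, K) \<in> p1" for x K
            using that fine d(2) unfolding p1_def fine_def by blast
        qed
        finally show ?thesis .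
      qed
      have 2: "norm (\<Sum>z\<in>p - p1. ?err z) \<le> e1 * (b - a)"
      proof -
        have "norm (\<Sum>z\<in>p - p1. ?err z) \<le> (\<Sum>(x, K)\<in>p - p1. e1 * (Sup K - Inf K))"
        proof (rule sum_norm_le, safe)
          fix x K assume xK: "(x, K) \<in> p" "(x, K) \<notin> p1"
          then have xN: "x \<notin> N" by (auto simp: p1_def)
          obtain u v where K: "K = {u..v}" using tagged_division_ofD(4)[OF p xK(1)] by auto
          have x: "x \<in> K" and Kab: "K \<subseteq> {a..b}" using tagged_division_ofD(2,3)[OF p xK(1)] by auto
          have uv: "u \<le> v" using x K by auto
          have Kb: "K \<subseteq> ball x (d x)" using fine xK(1) unfolding fine_def by blast
          have mem: "u \<in> K" "v \<in> K" "x \<in> {a..b} - N" using K uv x Kab xN by auto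
          \<comment> \<open>The tag lies between \<open>u\<close> and \<open>v\<close>, so the two
            linearisation errors taken from the tag add up to a multiple of \<open>v - u\<close>,
            even if the tag is an endpoint.\<close>
          have "norm (f u - f x - (u-x) * g x) \<le> e1 * norm (u-x)" "norm (f v - f x - (v-x) * g x) \<le> e1 * norm (v-x)"
            by (rule d(3)[OF mem(3)]; use mem Kab Kb in \<open>auto simp: dist_real_def subset_iff abs_minus_commute\<close>)+
          moreover have "norm (u - x) = x - u" "norm (v - x) = v - x" using x K by auto
          ultimately have "norm ((v - u) * g x - (f v - f u)) \<le> e1 * (x - u) + e1 * (v - x)"
            using norm_triangle_ineq4[of "f u - f x - (u-x) * g x" "f v - f x - (v-x) * g x"]
            by (simp add: algebra_simps)
          then have "norm ((v - u) * g x - (f v - f u)) \<le> e1 * (v - u)" by (simp add: algebra_simps)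
          then show "norm (measure lborel K *\<^sub>R g0 x - (f (Sup K) - f (Inf K))) \<le> e1 * (Sup K - Inf K)"
            using uv xN by (simp add: K g0_def)
        qed
        also have "\<dots> \<le> (\<Sum>(x, K)\<in>p. e1 * (Sup K - Inf K))"
        proof (rule sum_mono2[OF fin], blast)
          show "0 \<le> (case z of (x, K) \<Rightarrow> e1 * (Sup K - Inf K))" if zp: "z \<in> p - (p - p1)" for z
          proof -
            obtain x K where z: "z = (x, K)" "(x, K) \<in> p" using zp by (cases z) auto
            obtain u v where K: "K = {u..v}" using tagged_division_ofD(4)[OF p z(2)] by auto
            have "x \<in> K" using tagged_division_ofD(2)[OF p z(2)] by auto
            with K have "u \<le> v" by auto
            then show ?thesis using e1 by (simp add: z K)
          qed
        qed
        also have "\<dots> = e1 * (b - a)"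
          using additive_tagged_division_1[OF ab p, of "\<lambda>x. x"]
          by (simp add: sum_distrib_left[symmetric] case_prod_beta)
        finally show ?thesis .
      qed
      have "(\<Sum>(x, K)\<in>p. measure lborel K *\<^sub>R g0 x) - (f b - f a) = (\<Sum>z\<in>p. ?err z)"
        by (simp add: additive_tagged_division_1[OF ab p, of f, symmetric] sum_subtractf case_prod_beta)
      also have "\<dots> = (\<Sum>z\<in>p - p1. ?err z) + (\<Sum>z\<in>p1. ?err z)"
        using sum.subset_diff[OF p1 fin] .
      finally have "norm ((\<Sum>(x, K)\<in>p. measure lborel K *\<^sub>R g0 x) - (f b - f a)) < e1 * (b - a) + e / 2"
        using 1 2 norm_triangle_ineq[of "\<Sum>z\<in>p - p1. ?err z" "\<Sum>z\<in>p1. ?err z"]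
        by (simp only:)
      also have "e1 * (b - a) \<le> e / 2" unfolding e1_def using e ab by (simp add: field_simps)
      finally show "norm ((\<Sum>(x, K)\<in>p. measure lborel K *\<^sub>R g0 x) - (f b - f a)) < e" by simp
    qed
  qed
  then show ?thesis
    by (rule has_integral_spike[OF negl, rotated]) (auto simp: g0_def)
qed


section \<open>Indefinite Lebesgue integrals\<close>

lemma set_integral_diff_atMost:
  fixes f :: "real \<Rightarrow> real"
  assumes f: "integrable lborel f" and "a \<le> b"
  shows "(LBINT s:{..b}. f s) - (LBINT s:{..a}. f s) = (LBINT s:{a<..b}. f s)"
proof -
  have int: "set_integrable lborel A f" if "A \<in> sets borel" for A
    using integrable_mult_indicator[OF _ f, of A] that by (simp add: set_integrable_def)
  have "{..b} = {..a} \<union> {a<..b}" using \<open>a \<le> b\<close> by auto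
  then show ?thesis
    using set_integral_Un[OF _ int int, of "{..a}" "{a<..b}"] by (simp add: disjoint_iff)
qed

text \<open>Both sets agree with the open interval up to its endpoints, which have measure zero.
  This reconciles the closed, open and half-open ranges arising from the exponents, from additivity
  and from the recursion.\<close>

lemma set_integral_interval_eq:
  fixes f :: "real \<Rightarrow> real"
  assumes f: "integrable lborel f" and AB: "{a<..<b} \<subseteq> A" "A \<subseteq> {a..b}" "{a<..<b} \<subseteq> B" "B \<subseteq> {a..b}"
    "A \<in> sets borel" "B \<in> sets borel"
  shows "(LBINT s:A. f s) = (LBINT s:B. f s)"
proof (rule set_integral_null_delta)
  have "A \<subseteq> {a<..<b} \<union> {a, b}" "B \<subseteq> {a<..<b} \<union> {a, b}" using AB(2,4) by fastforce+
  then have "(A - B) \<union> (B - A) \<subseteq> {a, b}" using AB(1,3) by blast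
  then have "finite ((A - B) \<union> (B - A))" by (rule finite_subset) simp
  then show "(A - B) \<union> (B - A) \<in> null_sets lborel" by (rule finite_imp_null_set_lborel)
qed (use AB f in auto)

text \<open>Truncation at height \<open>M\<close>: the part of \<open>f\<close> below
  \<open>M\<close> contributes at most \<open>M\<close> times the total length, and the remaining
  \<open>tail M\<close> has a small integral over the whole line by dominated convergence.\<close>

theorem absolutely_continuous_on_indefinite_integral:
  fixes f :: "real \<Rightarrow> real"
  assumes f: "integrable lborel f"
  shows "absolutely_continuous_on I (\<lambda>u. LBINT s:{..u}. f s)"
  unfolding absolutely_continuous_on_iff_increments_below
proof (intro allI impI)
  fix \<epsilon> :: real assume \<epsilon>: "\<epsilon> > 0"
  define tail where "tail n s = \<bar>f s\<bar> - min \<bar>f s\<bar> (real n)" for n s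
  have [measurable]: "f \<in> borel_measurable lborel" using f by simp
  have tail_nonneg: "0 \<le> tail n s" for n s by (simp add: tail_def)
  have [measurable]: "tail n \<in> borel_measurable borel" for n unfolding tail_def by measurable
  have tail_int: "integrable lborel (tail n)" for n
    by (rule Bochner_Integration.integrable_bound[OF f]) (auto simp: tail_def)
  have "(\<lambda>n. \<integral>s. tail n s \<partial>lborel) \<longlonglongrightarrow> (\<integral>s. 0 \<partial>(lborel :: real measure))"
  proof (rule integral_dominated_convergence[where w = "\<lambda>s. \<bar>f s\<bar>"])
    show "AE s in lborel. (\<lambda>n. tail n s) \<longlonglongrightarrow> 0"
    proof (rule AE_I2)
      fix s
      have "eventually (\<lambda>n. tail n s = 0) sequentially"
        using eventually_ge_at_top[of "nat \<lceil>\<bar>f s\<bar>\<rceil>"]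
        by eventually_elim (simp add: tail_def nat_le_iff ceiling_le_iff)
      then show "(\<lambda>n. tail n s) \<longlonglongrightarrow> 0" by (rule tendsto_eventually)
    qed
  qed (use f in \<open>auto simp: tail_def\<close>)
  then have "eventually (\<lambda>n. (\<integral>s. tail n s \<partial>lborel) < \<epsilon> / 2) sequentially"
    using \<epsilon> by (intro order_tendstoD(2)) auto
  then obtain M where M: "(\<integral>s. tail M s \<partial>lborel) < \<epsilon> / 2"
    by (auto simp: eventually_sequentially)
  \<comment> \<open>Chosen so that the truncated part contributes at most
    \<open>\<epsilon> / 2\<close>; adding 1 covers \<open>M = 0\<close>.\<close>
  define \<delta> where "\<delta> = \<epsilon> / (2 * (real M + 1))"
  have \<delta>: "\<delta> > 0" unfolding \<delta>_def using \<epsilon> by simp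
  have single: "\<bar>(LBINT s:{..b}. f s) - (LBINT s:{..a}. f s)\<bar> \<le> (LBINT s:{a<..<b}. tail M s) + real M * (b - a)"
    if "a \<le> b" for a b
  proof -
    have "(LBINT s:{..b}. f s) - (LBINT s:{..a}. f s) = (LBINT s:{a<..<b}. f s)"
      unfolding set_integral_diff_atMost[OF f that] by (rule set_integral_interval_eq[OF f]) auto
    also have "\<bar>\<dots>\<bar> \<le> (\<integral>s. indicator {a<..<b} s * tail M s + real M * indicator {a<..<b} s \<partial>lborel)"
      unfolding set_lebesgue_integral_def
    proof (rule integral_abs_bound_integral)
      show "integrable lborel (\<lambda>s. indicator {a<..<b} s *\<^sub>R f s)"
        by (rule integrable_mult_indicator) (use f in auto)
      show "integrable lborel (\<lambda>s. indicator {a<..<b} s * tail M s + real M * indicator {a<..<b} s)"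
        using integrable_mult_indicator[OF _ tail_int, of "{a<..<b}"]
        by (intro Bochner_Integration.integrable_add integrable_mult_right) (auto simp: that emeasure_lborel_Ioo)
    qed (auto simp: tail_def indicator_def)
    also have "\<dots> = (LBINT s:{a<..<b}. tail M s) + real M * (b - a)"
      using integrable_mult_indicator[OF _ tail_int, of "{a<..<b}"] that
      by (subst Bochner_Integration.integral_add) (auto simp: set_lebesgue_integral_def)
    finally show ?thesis .
  qed
  have "increments_below I (\<lambda>u. LBINT s:{..u}. f s) \<delta> \<epsilon>"
  proof (rule increments_belowI)
    fix n :: nat and a b :: "nat \<Rightarrow> real"
    assume ab: "\<And>i. i < n \<Longrightarrow> a i \<le> b i" and disj: "disjoint_family_on (\<lambda>i. {a i<..<b i}) {..<n}"
      and small: "(\<Sum>i<n. b i - a i) < \<delta>"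
    have "(\<Sum>i<n. \<bar>(LBINT s:{..b i}. f s) - (LBINT s:{..a i}. f s)\<bar>)
        \<le> (\<Sum>i<n. (LBINT s:{a i<..<b i}. tail M s) + real M * (b i - a i))"
      using ab by (intro sum_mono single) auto
    also have "\<dots> = (\<Sum>i<n. LBINT s:{a i<..<b i}. tail M s) + real M * (\<Sum>i<n. b i - a i)"
      by (simp add: sum.distrib sum_distrib_left)
    also have "(\<Sum>i<n. LBINT s:{a i<..<b i}. tail M s) = (\<integral>s. (\<Sum>i<n. indicator {a i<..<b i} s * tail M s) \<partial>lborel)"
      using integrable_mult_indicator[OF _ tail_int]
      by (subst Bochner_Integration.integral_sum) (auto simp: set_lebesgue_integral_def)
    also have "\<dots> \<le> (\<integral>s. tail M s \<partial>lborel)"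
    proof (rule integral_mono)
      show "integrable lborel (\<lambda>s. \<Sum>i<n. indicator {a i<..<b i} s * tail M s)"
        using integrable_mult_indicator[OF _ tail_int] by (intro Bochner_Integration.integrable_sum) auto
      fix s
      \<comment> \<open>Disjointness bounds the sum of the indicators by 1, so the tails over all
        intervals together cost no more than one integral of \<open>tail M\<close>.\<close>
      have "(\<Sum>i<n. indicator {a i<..<b i} s :: real) = indicator (\<Union>i<n. {a i<..<b i}) s"
        using disj by (subst indicator_UN_disjoint) auto
      also have "\<dots> \<le> 1" by (simp add: indicator_def)
      finally show "(\<Sum>i<n. indicator {a i<..<b i} s * tail M s) \<le> tail M s"
        using mult_right_mono[OF _ tail_nonneg[of M s]] by (simp add: sum_distrib_right[symmetric]) fastforce
    qed (rule tail_int)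
    also have "real M * (\<Sum>i<n. b i - a i) \<le> real M * \<delta>"
      using small by (intro mult_left_mono) auto
    also have "real M * \<delta> \<le> \<epsilon> / 2" unfolding \<delta>_def using \<epsilon> by (simp add: field_simps)
    finally show "(\<Sum>i<n. \<bar>(LBINT s:{..b i}. f s) - (LBINT s:{..a i}. f s)\<bar>) < \<epsilon>" using M by simp
  qed
  then show "\<exists>\<delta>>0. increments_below I (\<lambda>u. LBINT s:{..u}. f s) \<delta> \<epsilon>" using \<delta> by blast
qed

text \<open>The library has the differentiation theorem for right-hand averages; the left-hand ones are those of
  the reflected function.\<close>

theorem AE_has_real_derivative_indefinite_integral:
  fixes f :: "real \<Rightarrow> real"
  assumes f: "integrable lborel f"
  shows "AE u in lborel. ((\<lambda>u. LBINT s:{..u}. f s) has_real_derivative f u) (at u)"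
proof -
  define F where "F u = (LBINT s:{..u}. f s)" for u
  have hk: "(f has_integral (F b - F a)) {a..b}" if "a \<le> b" for a b
  proof -
    have "set_integrable lborel {a..b} f"
      using integrable_mult_indicator[OF _ f, of "{a..b}"] by (simp add: set_integrable_def)
    then have "(f has_integral (LBINT s:{a..b}. f s)) {a..b}"
      using set_borel_integral_eq_integral[of "{a..b}" f] by (simp add: has_integral_iff)
    also have "(LBINT s:{a..b}. f s) = F b - F a"
      unfolding F_def set_integral_diff_atMost[OF f that] by (rule set_integral_interval_eq[OF f]) auto
    finally show ?thesis .
  qed
  have intble: "f integrable_on cbox a b" for a b
    using hk[of a b] by (cases "a \<le> b") auto
  have intble': "(\<lambda>s. f (- s)) integrable_on cbox a b" for a b
    using intble[of "- b" "- a"] Henstock_Kurzweil_Integration.integrable_reflect_real[where f = f and a = "- b" and b = "- a"] by simp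
  obtain N1 where N1: "negligible N1" "\<And>x e. x \<notin> N1 \<Longrightarrow> 0 < e \<Longrightarrow>
      \<exists>d>0. \<forall>h. 0 < h \<and> h < d \<longrightarrow> norm (integral (cbox x (x + h *\<^sub>R One)) f /\<^sub>R h ^ DIM(real) - f x) < e"
    using integrable_ccontinuous_explicit[OF intble] by metis
  obtain N2 where N2: "negligible N2" "\<And>x e. x \<notin> N2 \<Longrightarrow> 0 < e \<Longrightarrow>
      \<exists>d>0. \<forall>h. 0 < h \<and> h < d \<longrightarrow>
        norm (integral (cbox x (x + h *\<^sub>R One)) (\<lambda>s. f (- s)) /\<^sub>R h ^ DIM(real) - f (- x)) < e"
    using integrable_ccontinuous_explicit[OF intble'] by metis
  \<comment> \<open>\<open>N2\<close> contains the bad points of the reflected function, so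
    \<open>u\<close> must avoid its mirror image; reflection, being differentiable, keeps it
    negligible.\<close>
  have "negligible (N1 \<union> uminus ` N2)"
    using N1(1) N2(1)
    by (intro negligible_Un negligible_differentiable_image_negligible) (auto intro!: derivative_intros simp: differentiable_on_def)
  then have "AE u in lebesgue. u \<notin> N1 \<union> uminus ` N2"
    unfolding negligible_iff_null_sets by (rule AE_not_in)
  then have "AE u in lborel. u \<notin> N1 \<union> uminus ` N2"
    unfolding AE_completion_iff .
  then show ?thesis
  proof (eventually_elim)
    fix u assume "u \<notin> N1 \<union> uminus ` N2"
    then have u: "u \<notin> N1" "- u \<notin> N2" by (auto simp: image_iff)
    have "\<exists>d>0. \<forall>y. y \<noteq> u \<and> \<bar>y - u\<bar> < d \<longrightarrow> \<bar>(F y - F u) / (y - u) - f u\<bar> < e" if e: "e > 0" for e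
    proof -
      obtain d1 where d1: "d1 > 0" "\<And>h. 0 < h \<Longrightarrow> h < d1 \<Longrightarrow> \<bar>integral {u..u + h} f / h - f u\<bar> < e"
        using N1(2)[OF u(1) e] by (auto simp: field_simps)
      obtain d2 where d2: "d2 > 0" "\<And>h. 0 < h \<Longrightarrow> h < d2 \<Longrightarrow> \<bar>integral {-u..-u + h} (\<lambda>s. f (- s)) / h - f u\<bar> < e"
        using N2(2)[OF u(2) e] by (auto simp: field_simps)
      have "\<bar>(F y - F u) / (y - u) - f u\<bar> < e" if y: "y \<noteq> u" "\<bar>y - u\<bar> < min d1 d2" for y
      proof (cases "u < y")
        case True
        then show ?thesis using d1(2)[of "y - u"] y integral_unique[OF hk[of u y]] by simp
      next
        case False
        have "integral {-u..-y} (\<lambda>s. f (- s)) = F u - F y"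
          using False integral_unique[OF hk[of y u]] by simp
        moreover have "(F u - F y) / (u - y) = (F y - F u) / (y - u)"
          by (metis minus_diff_eq minus_divide_divide)
        ultimately show ?thesis using d2(2)[of "u - y"] y False by simp
      qed
      then show ?thesis using d1(1) d2(1) by (intro exI[of _ "min d1 d2"]) auto
    qed
    then show "((\<lambda>u. LBINT s:{..u}. f s) has_real_derivative f u) (at u)"
      unfolding F_def[symmetric] has_field_derivative_iff LIM_def by (simp add: dist_real_def)
  qed
qed

text \<open>For a nonnegative integrand the gauge integral from the fundamental theorem is also the
  Lebesgue integral, so finiteness comes together with the value.\<close>

lemma absolutely_continuous_on_decreasing_nn_integral:
  fixes f k :: "real \<Rightarrow> real"
  assumes "absolutely_continuous_on {a..b} f" "a \<le> b" and k: "\<And>u. 0 \<le> k u"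
    and "AE u in lborel. u \<in> {a..b} \<longrightarrow> (f has_real_derivative - k u) (at u within {a..b})"
  shows "(\<integral>\<^sup>+u\<in>{a..b}. ennreal (k u) \<partial>lborel) = ennreal (f a - f b)" "f b \<le> f a"
proof -
  have "((\<lambda>u. - k u) has_integral (f b - f a)) {a..b}"
    by (rule absolutely_continuous_on_FTC) fact+
  from has_integral_neg[OF this] have *: "(k has_integral (f a - f b)) {a..b}" by simp
  show "(\<integral>\<^sup>+u\<in>{a..b}. ennreal (k u) \<partial>lborel) = ennreal (f a - f b)"
    by (rule nn_integral_has_integral_lebesgue'[OF k *])
  show "f b \<le> f a" using has_integral_nonneg[OF * k] by simp
qed

section \<open>Jump kernels and their series\<close>

text \<open>A Q-function is used only on a time interval \<open>[T0, t]\<close>; the locale assumes it extended by zero jump rates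
  to all times, which makes the cumulative rates finite and starting at 0 at time minus infinity.\<close>

locale jump_kernel =
  fixes X :: "'a measure" and K :: "real \<Rightarrow> 'a \<Rightarrow> 'a measure"
  assumes sets_K: "\<And>w x. x \<in> space X \<Longrightarrow> sets (K w x) = sets X"
    and measurable_emeasure_K:
      "\<And>A. A \<in> sets X \<Longrightarrow> (\<lambda>(w, x). emeasure (K w x) A) \<in> borel_measurable (borel \<Otimes>\<^sub>M X)"
    and finite_K: "\<And>w x. x \<in> space X \<Longrightarrow> emeasure (K w x) (space X) < \<infinity>"
    and nn_integral_K: "\<And>x. x \<in> space X \<Longrightarrow> (\<integral>\<^sup>+w. emeasure (K w x) (space X) \<partial>lborel) < \<infinity>"
begin

definition r :: "real \<Rightarrow> 'a \<Rightarrow> real" where "r w x = measure (K w x) (space X)"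

text \<open>Starting at minus infinity instead of at \<open>u\<close> makes the exponent a
  difference of two values of one function, which separates the variables in
  \<open>E\<close>.\<close>

definition G :: "real \<Rightarrow> 'a \<Rightarrow> real" where "G u x = (LBINT s:{..u}. r s x)"

definition E :: "'a \<Rightarrow> real \<Rightarrow> real \<Rightarrow> real" where "E x u w = exp (G u x - G w x)"

lemma space_K: "x \<in> space X \<Longrightarrow> space (K w x) = space X"
  using sets_eq_imp_space_eq[OF sets_K] .

lemma emeasure_K: "x \<in> space X \<Longrightarrow> emeasure (K w x) (space X) = ennreal (r w x)"
  unfolding r_def using finite_K[of x w] by (intro emeasure_eq_ennreal_measure) auto

lemma r_nonneg [simp]: "0 \<le> r w x" by (simp add: r_def)

lemma measurable_r [measurable (raw)]:
  assumes [measurable]: "f \<in> borel_measurable M" "g \<in> M \<rightarrow>\<^sub>M X"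
  shows "(\<lambda>z. r (f z) (g z)) \<in> borel_measurable M"
proof -
  have [measurable]: "(\<lambda>(w, x). emeasure (K w x) (space X)) \<in> borel_measurable (borel \<Otimes>\<^sub>M X)"
    by (rule measurable_emeasure_K) simp
  have "(\<lambda>z. enn2real ((\<lambda>(w, x). emeasure (K w x) (space X)) (f z, g z))) \<in> borel_measurable M"
    by measurable
  then show ?thesis by (simp add: r_def measure_def)
qed

lemma integrable_r: "x \<in> space X \<Longrightarrow> integrable lborel (\<lambda>w. r w x)"
  using nn_integral_K[of x] by (intro integrableI_nonneg) (auto simp: emeasure_K)

lemma measurable_G [measurable (raw)]:
  assumes [measurable]: "f \<in> borel_measurable M" "g \<in> M \<rightarrow>\<^sub>M X"
  shows "(\<lambda>z. G (f z) (g z)) \<in> borel_measurable M"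
proof -
  have [measurable]: "Measurable.pred (M \<Otimes>\<^sub>M borel) (\<lambda>z. snd z \<in> {..f (fst z)})"
    unfolding atMost_iff by measurable
  show ?thesis unfolding G_def set_lebesgue_integral_def by measurable
qed

lemma measurable_E [measurable (raw)]:
  assumes [measurable]: "f \<in> borel_measurable M" "g \<in> borel_measurable M" "h \<in> M \<rightarrow>\<^sub>M X"
  shows "(\<lambda>z. E (h z) (f z) (g z)) \<in> borel_measurable M"
  unfolding E_def by measurable

lemma G_nonneg: "0 \<le> G u x"
  unfolding G_def set_lebesgue_integral_def by (rule integral_nonneg_AE) (auto simp: indicator_def)

lemma G_le: "x \<in> space X \<Longrightarrow> G u x \<le> (\<integral>s. r s x \<partial>lborel)"
  unfolding G_def set_lebesgue_integral_def
  by (rule integral_mono'[OF integrable_r]) (auto simp: indicator_def)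

lemma G_mono: "x \<in> space X \<Longrightarrow> u \<le> w \<Longrightarrow> G u x \<le> G w x"
  unfolding G_def set_lebesgue_integral_def
  by (rule integral_mono'[OF integrable_mult_indicator[OF _ integrable_r]]) (auto simp: indicator_def)

lemma absolutely_continuous_on_G: "x \<in> space X \<Longrightarrow> absolutely_continuous_on I (\<lambda>u. G u x)"
  unfolding G_def by (rule absolutely_continuous_on_indefinite_integral[OF integrable_r])

lemma DERIV_G: "x \<in> space X \<Longrightarrow> AE u in lborel. ((\<lambda>u. G u x) has_real_derivative r u x) (at u)"
  unfolding G_def by (rule AE_has_real_derivative_indefinite_integral[OF integrable_r])

text \<open>Since \<open>G\<close> is nonnegative, the exponent never exceeds \<open>G u x\<close>,
  and \<open>exp\<close> is Lipschitz on that range.\<close>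

lemma absolutely_continuous_on_E:
  assumes x: "x \<in> space X"
  shows "absolutely_continuous_on I (\<lambda>w. E x u w)"
  unfolding E_def
proof (rule absolutely_continuous_on_lipschitz_compose[where g = "\<lambda>y. exp (G u x - y)"])
  have "(exp (G u x) * 1)-lipschitz_on ((\<lambda>w. G w x) ` I) (exp \<circ> (\<lambda>y. G u x - y))"
    by (intro lipschitz_on_compose lipschitz_on_exp) (auto intro!: lipschitz_onI simp: dist_real_def G_nonneg)
  then show "(exp (G u x))-lipschitz_on ((\<lambda>w. G w x) ` I) (\<lambda>y. exp (G u x - y))" by (simp add: comp_def)
qed (rule absolutely_continuous_on_G[OF x])

lemma E_pos: "0 < E x u w" by (simp add: E_def)

lemma E_bounded: "bounded ((\<lambda>w. E x u w) ` I)"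
  by (rule boundedI[of _ "exp (G u x)"]) (auto simp: E_def G_nonneg)

text \<open>The law of the first jump time after \<open>u\<close>: either no jump occurs up to
  \<open>w\<close>, or the first one occurs at \<open>s\<close> with density
  \<open>E x u s * r s x\<close>. This density is minus the derivative of \<open>E\<close> in its
  last argument.\<close>

lemma nn_integral_E_r:
  assumes x: "x \<in> space X" and "u \<le> w"
  shows "ennreal (E x u w) + (\<integral>\<^sup>+s\<in>{u..<w}. ennreal (E x u s) * emeasure (K s x) (space X) \<partial>lborel) = 1"
proof -
  have ae: "AE s in lborel. s \<in> {u..w} \<longrightarrow> ((\<lambda>s. E x u s) has_real_derivative - (E x u s * r s x)) (at s within {u..w})"
    using DERIV_G[OF x]
  proof eventually_elim
    fix s assume d: "((\<lambda>u. G u x) has_real_derivative r s x) (at s)"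
    show "s \<in> {u..w} \<longrightarrow> ((\<lambda>s. E x u s) has_real_derivative - (E x u s * r s x)) (at s within {u..w})"
      unfolding E_def by (auto intro!: derivative_eq_intros has_field_derivative_at_within[OF d])
  qed
  have "(\<integral>\<^sup>+s\<in>{u..<w}. ennreal (E x u s) * emeasure (K s x) (space X) \<partial>lborel)
      = (\<integral>\<^sup>+s\<in>{u..w}. ennreal (E x u s * r s x) \<partial>lborel)"
    using AE_lborel_singleton[of w]
    by (intro nn_integral_cong_AE)
       (auto simp: emeasure_K[OF x] ennreal_mult E_pos less_imp_le indicator_def)
  also have "\<dots> = ennreal (E x u u - E x u w)"
    by (rule absolutely_continuous_on_decreasing_nn_integral(1)[OF absolutely_continuous_on_E[OF x] \<open>u \<le> w\<close> _ ae])
       (simp add: E_pos less_imp_le)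
  also have "E x u u = 1" by (simp add: E_def)
  finally show ?thesis
    using G_mono[OF x \<open>u \<le> w\<close>] by (simp add: E_def flip: ennreal_plus)
qed

text \<open>The Giry monad only has subprobability kernels, hence the normalisation of the kernel.\<close>

lemma measurable_nn_integral_K [measurable (raw)]:
  assumes h: "(\<lambda>(z, y). h z y) \<in> borel_measurable (M \<Otimes>\<^sub>M X)"
    and f [measurable]: "f \<in> borel_measurable M" and g [measurable]: "g \<in> M \<rightarrow>\<^sub>M X"
  shows "(\<lambda>z. \<integral>\<^sup>+y. h z y \<partial>K (f z) (g z)) \<in> borel_measurable M"
proof -
  \<comment> \<open>This exceeds the total mass of the kernel, so dividing by it gives a
    subprobability; the summand 1 makes it invertible even where the kernel vanishes.\<close>
  define c where "c z = ennreal (1 + r (f z) (g z))" for z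
  have c: "c z * inverse (c z) = 1" for z
  proof -
    have "0 < 1 + r (f z) (g z)" using r_nonneg[of "f z" "g z"] by linarith
    then show ?thesis
      unfolding c_def by (simp add: inverse_ennreal del: ennreal_plus flip: ennreal_mult)
  qed
  have g_space: "g z \<in> space X" if "z \<in> space M" for z using measurable_space[OF g that] .
  define L where "L z = scale_measure (inverse (c z)) (K (f z) (g z))" for z
  have L: "L \<in> M \<rightarrow>\<^sub>M subprob_algebra X"
  proof (rule measurable_subprob_algebra)
    fix z assume z: "z \<in> space M"
    show "sets (L z) = sets X" using sets_K[OF g_space[OF z]] by (simp add: L_def)
    show "subprob_space (L z)"
    proof (rule subprob_spaceI)
      have "emeasure (L z) (space (L z)) = inverse (c z) * ennreal (r (f z) (g z))"
        by (simp add: L_def space_scale_measure space_K[OF g_space[OF z]] emeasure_K[OF g_space[OF z]])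
      also have "\<dots> \<le> inverse (c z) * c z" by (intro mult_left_mono) (auto simp: c_def intro!: ennreal_leI)
      finally show "emeasure (L z) (space (L z)) \<le> 1" using c[of z] by (simp add: mult.commute)
      show "space (L z) \<noteq> {}" using g_space[OF z] by (auto simp: L_def space_scale_measure space_K)
    qed
  next
    fix A assume "A \<in> sets X"
    then have [measurable]: "(\<lambda>(w, x). emeasure (K w x) A) \<in> borel_measurable (borel \<Otimes>\<^sub>M X)"
      by (rule measurable_emeasure_K)
    have "(\<lambda>z. inverse (c z) * (\<lambda>(w, x). emeasure (K w x) A) (f z, g z)) \<in> borel_measurable M"
      unfolding c_def by measurable
    then show "(\<lambda>z. emeasure (L z) A) \<in> borel_measurable M"
      by (simp add: L_def)
  qed
  have "(\<lambda>z. c z * (\<integral>\<^sup>+y. h z y \<partial>L z)) \<in> borel_measurable M"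
    using nn_integral_measurable_subprob_algebra2[OF h L] unfolding c_def by measurable
  also have "?this \<longleftrightarrow> ?thesis"
  proof (rule measurable_cong)
    fix z assume z: "z \<in> space M"
    have "h z \<in> borel_measurable X" using h z by measurable
    then have "h z \<in> borel_measurable (K (f z) (g z))"
      by (simp cong: measurable_cong_sets add: sets_K[OF g_space[OF z]])
    then show "c z * (\<integral>\<^sup>+y. h z y \<partial>L z) = (\<integral>\<^sup>+y. h z y \<partial>K (f z) (g z))"
      by (simp add: L_def nn_integral_scale_measure c flip: mult.assoc)
  qed
  finally show ?thesis .
qed

text \<open>\<open>E x u w\<close> is the probability of no jump from \<open>x\<close> during \<open>[u, w]\<close>, and \<open>F B t n u x\<close> is the paper's
  \<open>P\<close> with superscript \<open>(n)\<close> at \<open>(u, x; t, B)\<close>.\<close>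

primrec F :: "'a set \<Rightarrow> real \<Rightarrow> nat \<Rightarrow> real \<Rightarrow> 'a \<Rightarrow> ennreal" where
  "F B t 0 u x = indicator B x * ennreal (E x u t)"
| "F B t (Suc n) u x =
     (\<integral>\<^sup>+w\<in>{u..<t}. ennreal (E x u w) * (\<integral>\<^sup>+y. F B t n w y \<partial>K w x) \<partial>lborel)"

lemma measurable_F [measurable (raw)]:
  assumes B [measurable]: "B \<in> sets X" and [measurable]: "f \<in> borel_measurable M" "g \<in> M \<rightarrow>\<^sub>M X"
  shows "(\<lambda>z. F B t n (f z) (g z)) \<in> borel_measurable M"
proof -
  \<comment> \<open>The induction needs joint measurability in time and state, since the recursion
    integrates over both; \<open>f\<close> and \<open>g\<close> are substituted only
    afterwards.\<close>
  have "(\<lambda>(u, x). F B t n u x) \<in> borel_measurable (borel \<Otimes>\<^sub>M X)"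
  proof (induction n)
    case (Suc n)
    note [measurable] = Suc
    have [measurable]: "Measurable.pred ((borel \<Otimes>\<^sub>M X) \<Otimes>\<^sub>M lborel) (\<lambda>x. snd x \<in> {fst (fst x)..<t})"
      unfolding atLeastLessThan_iff by measurable
    show ?case by simp
  qed simp
  note [measurable] = this
  have "(\<lambda>z. (\<lambda>(u, x). F B t n u x) (f z, g z)) \<in> borel_measurable M" by measurable
  then show ?thesis by simp
qed

lemma measurable_F_K [measurable]:
  "B \<in> sets X \<Longrightarrow> x \<in> space X \<Longrightarrow> F B t n w \<in> borel_measurable (K v x)"
  using measurable_F[of B "\<lambda>_. w" X "\<lambda>y. y" t n] by (simp cong: measurable_cong_sets add: sets_K)

section \<open>The series as least supersolution\<close>

definition S :: "'a set \<Rightarrow> real \<Rightarrow> real \<Rightarrow> 'a \<Rightarrow> ennreal" where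
  "S B t u x = (\<Sum>n. F B t n u x)"

lemma measurable_S [measurable (raw)]:
  assumes [measurable]: "B \<in> sets X" "f \<in> borel_measurable M" "g \<in> M \<rightarrow>\<^sub>M X"
  shows "(\<lambda>z. S B t (f z) (g z)) \<in> borel_measurable M"
  unfolding S_def by measurable

lemma measurable_S_K [measurable]:
  "B \<in> sets X \<Longrightarrow> x \<in> space X \<Longrightarrow> S B t w \<in> borel_measurable (K v x)"
  using measurable_S[of B "\<lambda>_. w" X "\<lambda>y. y" t] by (simp cong: measurable_cong_sets add: sets_K)

text \<open>This is the Picard recursion: the term without jumps is split off, and linearity
  collects the others under both integrals. For \<open>n = 0\<close> the inner sum is the zero
  function.\<close>

lemma sum_F_Suc:
  assumes [measurable]: "B \<in> sets X" and x [measurable]: "x \<in> space X"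
  shows "(\<Sum>k<Suc n. F B t k u x) = F B t 0 u x +
    (\<integral>\<^sup>+w\<in>{u..<t}. ennreal (E x u w) * (\<integral>\<^sup>+y. (\<Sum>k<n. F B t k w y) \<partial>K w x) \<partial>lborel)"
proof -
  have "(\<integral>\<^sup>+w\<in>{u..<t}. ennreal (E x u w) * (\<integral>\<^sup>+y. (\<Sum>k<n. F B t k w y) \<partial>K w x) \<partial>lborel)
      = (\<integral>\<^sup>+w. (\<Sum>k<n. ennreal (E x u w) * (\<integral>\<^sup>+y. F B t k w y \<partial>K w x) * indicator {u..<t} w) \<partial>lborel)"
    by (subst nn_integral_sum) (auto simp: x sum_distrib_left sum_distrib_right)
  also have "\<dots> = (\<Sum>k<n. F B t (Suc k) u x)"
    by (subst nn_integral_sum) auto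
  finally show ?thesis by (simp add: sum.lessThan_Suc_shift del: sum.lessThan_Suc)
qed

lemma S_eq:
  assumes [measurable]: "B \<in> sets X" and x [measurable]: "x \<in> space X"
  shows "S B t u x = indicator B x * ennreal (E x u t) +
    (\<integral>\<^sup>+w\<in>{u..<t}. ennreal (E x u w) * (\<integral>\<^sup>+y. S B t w y \<partial>K w x) \<partial>lborel)"
proof -
  have "(\<integral>\<^sup>+w\<in>{u..<t}. ennreal (E x u w) * (\<integral>\<^sup>+y. S B t w y \<partial>K w x) \<partial>lborel)
      = (\<integral>\<^sup>+w. (\<Sum>k. ennreal (E x u w) * (\<integral>\<^sup>+y. F B t k w y \<partial>K w x) * indicator {u..<t} w) \<partial>lborel)"
    unfolding S_def by (subst nn_integral_suminf) (auto simp: x)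
  also have "\<dots> = (\<Sum>k. F B t (Suc k) u x)"
    by (subst nn_integral_suminf) auto
  finally show ?thesis
    unfolding S_def using suminf_offset[of "\<lambda>n. F B t n u x" 1] by simp
qed

text \<open>Zero lies below \<open>p\<close>, the monotone operator preserves this bound at each
  iteration, and \<open>p\<close> dominates its own image. The window \<open>{T..<t}\<close> is
  admissible because the operator at time \<open>u\<close> looks only at times in
  \<open>{u..<t}\<close>.\<close>

lemma S_le_supersolution:
  assumes B: "B \<in> sets X"
    and p: "\<And>u x. u \<in> {T..<t} \<Longrightarrow> x \<in> space X \<Longrightarrow> indicator B x * ennreal (E x u t) +
      (\<integral>\<^sup>+w\<in>{u..<t}. ennreal (E x u w) * (\<integral>\<^sup>+y. p w y \<partial>K w x) \<partial>lborel) \<le> p u x"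
    and u: "u \<in> {T..<t}" and x: "x \<in> space X"
  shows "S B t u x \<le> p u x"
proof -
  have "(\<Sum>k<n. F B t k u x) \<le> p u x" for n
    using u x
  proof (induction n arbitrary: u x)
    case (Suc n)
    have "(\<integral>\<^sup>+w\<in>{u..<t}. ennreal (E x u w) * (\<integral>\<^sup>+y. (\<Sum>k<n. F B t k w y) \<partial>K w x) \<partial>lborel)
        \<le> (\<integral>\<^sup>+w\<in>{u..<t}. ennreal (E x u w) * (\<integral>\<^sup>+y. p w y \<partial>K w x) \<partial>lborel)"
    proof (rule nn_integral_mono)
      fix w
      have "(\<integral>\<^sup>+y. (\<Sum>k<n. F B t k w y) \<partial>K w x) \<le> (\<integral>\<^sup>+y. p w y \<partial>K w x)" if "w \<in> {u..<t}"
        using that Suc by (intro nn_integral_mono Suc.IH) (auto simp: space_K)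
      then show "ennreal (E x u w) * (\<integral>\<^sup>+y. (\<Sum>k<n. F B t k w y) \<partial>K w x) * indicator {u..<t} w
          \<le> ennreal (E x u w) * (\<integral>\<^sup>+y. p w y \<partial>K w x) * indicator {u..<t} w"
        by (auto simp: indicator_def intro!: mult_left_mono)
    qed
    then show ?case
      unfolding sum_F_Suc[OF B Suc.prems(2)] using p[OF Suc.prems] by (auto intro: order_trans add_left_mono)
  qed simp
  then show ?thesis unfolding S_def by (intro suminf_le_const) auto
qed

text \<open>The constant 1 is a supersolution, by the balance \<open>nn_integral_E_r\<close> for the
  first jump.\<close>

lemma S_le_1:
  assumes B: "B \<in> sets X" and x: "x \<in> space X" and "u < t"
  shows "S B t u x \<le> 1"
proof (rule S_le_supersolution[OF B _ _ x, where p = "\<lambda>_ _. 1" and T = u])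
  fix v x assume u: "v \<in> {u..<t}" and x: "x \<in> space X"
  have "indicator B x * ennreal (E x v t) +
      (\<integral>\<^sup>+w\<in>{v..<t}. ennreal (E x v w) * (\<integral>\<^sup>+y. 1 \<partial>K w x) \<partial>lborel)
    \<le> ennreal (E x v t) + (\<integral>\<^sup>+s\<in>{v..<t}. ennreal (E x v s) * emeasure (K s x) (space X) \<partial>lborel)"
    by (intro add_mono) (auto simp: indicator_def space_K[OF x])
  also have "\<dots> = 1" using u by (intro nn_integral_E_r[OF x]) auto
  finally show "indicator B x * ennreal (E x v t) +
      (\<integral>\<^sup>+w\<in>{v..<t}. ennreal (E x v w) * (\<integral>\<^sup>+y. 1 \<partial>K w x) \<partial>lborel) \<le> 1" .
qed (use \<open>u < t\<close> in auto)

lemma F_UN: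
  fixes A :: "nat \<Rightarrow> 'a set"
  assumes [measurable]: "\<And>i. A i \<in> sets X" and disj: "disjoint_family A" and "x \<in> space X"
  shows "F (\<Union>i. A i) t n u x = (\<Sum>i. F (A i) t n u x)"
  using \<open>x \<in> space X\<close>
proof (induction n arbitrary: u x)
  case 0
  have "(\<Sum>i. indicator (A i) x :: ennreal) = indicator (\<Union>i. A i) x"
    by (rule suminf_indicator[OF disj])
  then show ?case by simp
next
  case (Suc n)
  note [measurable] = Suc.prems
  have "F (\<Union>i. A i) t (Suc n) u x =
    (\<integral>\<^sup>+w\<in>{u..<t}. ennreal (E x u w) * (\<integral>\<^sup>+y. (\<Sum>i. F (A i) t n w y) \<partial>K w x) \<partial>lborel)"
    using Suc by (auto intro!: nn_integral_cong arg_cong2[where f = "(*)"] simp: space_K)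
  also have "\<dots> = (\<integral>\<^sup>+w. (\<Sum>i. ennreal (E x u w) * (\<integral>\<^sup>+y. F (A i) t n w y \<partial>K w x) * indicator {u..<t} w) \<partial>lborel)"
    by (subst nn_integral_suminf) (auto simp: Suc.prems)
  also have "\<dots> = (\<Sum>i. F (A i) t (Suc n) u x)"
    by (subst nn_integral_suminf) auto
  finally show ?case .
qed

lemma S_UN:
  fixes A :: "nat \<Rightarrow> 'a set"
  assumes "\<And>i. A i \<in> sets X" "disjoint_family A" "x \<in> space X"
  shows "S (\<Union>i. A i) t u x = (\<Sum>i. S (A i) t u x)"
proof -
  \<comment> \<open>Writing the series over \<open>n\<close> as an integral against counting measure
    turns the exchange of two series into the exchange of series and integral.\<close>
  have "S (\<Union>i. A i) t u x = (\<integral>\<^sup>+n. (\<Sum>i. F (A i) t n u x) \<partial>count_space UNIV)"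
    unfolding S_def nn_integral_count_space_nat[symmetric] F_UN[OF assms] ..
  also have "\<dots> = (\<Sum>i. S (A i) t u x)"
    by (subst nn_integral_suminf) (auto simp: S_def nn_integral_count_space_nat)
  finally show ?thesis .
qed

section \<open>The backward equation\<close>

text \<open>The bound \<open>S \<le> 1\<close> is available only before \<open>t\<close>; for
  \<open>u > t\<close> the factor \<open>E x u t\<close> may exceed 1. The cut-off keeps
  \<open>flow\<close> below the rate at all times, hence integrable, and does not affect integrals
  over \<open>{u..<t}\<close>.\<close>

definition flow :: "'a set \<Rightarrow> real \<Rightarrow> 'a \<Rightarrow> real \<Rightarrow> real" where
  "flow B t x w = (if w < t then enn2real (\<integral>\<^sup>+y. S B t w y \<partial>K w x) else 0)"

lemma measurable_flow:
  assumes [measurable]: "B \<in> sets X" "x \<in> space X"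
  shows "flow B t x \<in> borel_measurable borel"
proof -
  have "(\<lambda>w. if w < t then enn2real (\<integral>\<^sup>+y. S B t w y \<partial>K w x) else 0) \<in> borel_measurable borel"
    by measurable
  then show ?thesis unfolding flow_def[abs_def] .
qed

lemma flow_nonneg: "0 \<le> flow B t x w" by (simp add: flow_def)

lemma nn_integral_S_le:
  assumes "B \<in> sets X" and x: "x \<in> space X" and "w < t"
  shows "(\<integral>\<^sup>+y. S B t w y \<partial>K w x) \<le> ennreal (r w x)"
proof -
  have "(\<integral>\<^sup>+y. S B t w y \<partial>K w x) \<le> (\<integral>\<^sup>+y. 1 \<partial>K w x)"
    using assms by (intro nn_integral_mono S_le_1) (auto simp: space_K)
  then show ?thesis by (simp add: space_K[OF x] emeasure_K[OF x])
qed

text \<open>Since \<open>S\<close> is at most 1 and the kernel is finite, the inflow is finite. The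
  extended integral of the fixed point equation therefore agrees with the Bochner integral of the
  backward equation.\<close>

lemma flow_eq:
  assumes B: "B \<in> sets X" and x: "x \<in> space X" and w: "w < t"
  shows "(\<integral>\<^sup>+y. S B t w y \<partial>K w x) = ennreal (flow B t x w)"
    and "integrable (K w x) (\<lambda>y. enn2real (S B t w y))"
    and "(\<integral>y. enn2real (S B t w y) \<partial>K w x) = flow B t x w"
proof -
  have fin: "(\<integral>\<^sup>+y. S B t w y \<partial>K w x) < top"
    using nn_integral_S_le[OF B x w] by (auto simp: top_unique less_top intro: order_le_less_trans)
  then show "(\<integral>\<^sup>+y. S B t w y \<partial>K w x) = ennreal (flow B t x w)"
    using w by (simp add: flow_def less_top)
  have m: "(\<lambda>y. enn2real (S B t w y)) \<in> borel_measurable (K w x)"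
    using measurable_S_K[OF B x] by measurable
  have S: "ennreal (enn2real (S B t w y)) = S B t w y" if "y \<in> space X" for y
    using S_le_1[OF B that w] by (intro ennreal_enn2real) (auto intro: order_le_less_trans)
  have "(\<integral>\<^sup>+y. ennreal (enn2real (S B t w y)) \<partial>K w x) = (\<integral>\<^sup>+y. S B t w y \<partial>K w x)"
    using S by (intro nn_integral_cong) (simp add: space_K[OF x])
  then show "integrable (K w x) (\<lambda>y. enn2real (S B t w y))"
    "(\<integral>y. enn2real (S B t w y) \<partial>K w x) = flow B t x w"
    using fin w m by (auto intro!: integrableI_nonneg simp: integral_eq_nn_integral flow_def)
qed

lemma flow_le: "B \<in> sets X \<Longrightarrow> x \<in> space X \<Longrightarrow> flow B t x w \<le> r w x"
  using nn_integral_S_le[of B x w t] by (auto simp: flow_def enn2real_leI)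

text \<open>The integrand of the integral equation after the factor \<open>exp (G u x)\<close> has
  been taken out; what remains does not depend on \<open>u\<close>.\<close>

definition damped_flow :: "'a set \<Rightarrow> real \<Rightarrow> 'a \<Rightarrow> real \<Rightarrow> real" where
  "damped_flow B t x w = exp (- G w x) * flow B t x w"

lemma integrable_damped_flow:
  assumes B: "B \<in> sets X" and x [measurable]: "x \<in> space X"
  shows "integrable lborel (damped_flow B t x)"
proof (rule Bochner_Integration.integrable_bound[OF integrable_r[OF x]])
  note measurable_flow[OF B x, measurable]
  show "damped_flow B t x \<in> borel_measurable lborel"
    unfolding damped_flow_def[abs_def] by measurable
  have "exp (- G w x) * flow B t x w \<le> 1 * r w x" for w
    using flow_le[OF B x] by (intro mult_mono) (auto simp: G_nonneg flow_nonneg)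
  then show "AE w in lborel. norm (damped_flow B t x w) \<le> norm (r w x)"
    by (simp add: damped_flow_def abs_mult flow_nonneg)
qed

text \<open>Duhamel's formula: multiplied by the integrating factor \<open>exp (- G u x)\<close>, the solution is an indefinite
  integral.\<close>

lemma S_eq_Duhamel:
  assumes B: "B \<in> sets X" and x: "x \<in> space X" and u: "u \<le> t"
  shows "enn2real (S B t u x) = exp (G u x) * (indicator B x * exp (- G t x) +
      (LBINT w:{..t}. damped_flow B t x w) - (LBINT w:{..u}. damped_flow B t x w))"
proof -
  note int = integrable_damped_flow[OF B x]
  let ?D = "(LBINT w:{..t}. damped_flow B t x w) - (LBINT w:{..u}. damped_flow B t x w)"
  have nn: "0 \<le> damped_flow B t x w" for w by (simp add: damped_flow_def flow_nonneg)
  have "(\<integral>\<^sup>+w\<in>{u..<t}. ennreal (E x u w) * (\<integral>\<^sup>+y. S B t w y \<partial>K w x) \<partial>lborel)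
      = (\<integral>\<^sup>+w. ennreal (exp (G u x) * (indicator {u..<t} w * damped_flow B t x w)) \<partial>lborel)"
    by (intro nn_integral_cong)
       (auto simp: indicator_def flow_eq[OF B x] E_def exp_diff exp_minus damped_flow_def field_simps
          flow_nonneg simp flip: ennreal_mult)
  also have "\<dots> = ennreal (exp (G u x) * (LBINT w:{u..<t}. damped_flow B t x w))"
    unfolding set_lebesgue_integral_def
    by (subst nn_integral_eq_integral)
       (use integrable_mult_indicator[OF _ int, of "{u..<t}"] in \<open>auto simp: nn\<close>)
  also have "(LBINT w:{u..<t}. damped_flow B t x w) = ?D"
    unfolding set_integral_diff_atMost[OF int u] by (rule set_integral_interval_eq[OF int]) (auto intro: less_imp_le)
  finally have S: "S B t u x = ennreal (indicator B x * E x u t) + ennreal (exp (G u x) * ?D)"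
    unfolding S_eq[OF B x] by (simp add: indicator_def)
  have "0 \<le> ?D"
    unfolding set_integral_diff_atMost[OF int u]
    by (simp add: set_lebesgue_integral_def nn integral_nonneg_AE)
  then have a: "0 \<le> exp (G u x) * ?D" by (intro mult_nonneg_nonneg) auto
  have b: "0 \<le> indicator B x * E x u t" by (simp add: E_pos less_imp_le)
  have "S B t u x = ennreal (indicator B x * E x u t + exp (G u x) * ?D)"
    unfolding S by (rule ennreal_plus[OF b a, symmetric])
  then have "enn2real (S B t u x) = indicator B x * E x u t + exp (G u x) * ?D"
    using a b by (metis add_nonneg_nonneg enn2real_ennreal)
  then show ?thesis by (simp add: E_def exp_diff exp_minus field_simps)
qed

text \<open>Duhamel's formula is a product of two bounded absolutely continuous functions. The
  endpoint \<open>t\<close> is included so that the boundary limit becomes continuity at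
  \<open>t\<close>.\<close>

lemma absolutely_continuous_on_S:
  assumes B: "B \<in> sets X" and x: "x \<in> space X"
  shows "absolutely_continuous_on {..t} (\<lambda>u. enn2real (S B t u x))"
proof (rule absolutely_continuous_on_cong)
  note int = integrable_damped_flow[OF B x]
  define c where "c = indicator B x * exp (- G t x) + (LBINT w:{..t}. damped_flow B t x w)"
  define D where "D u = (LBINT w:{..u}. damped_flow B t x w)" for u
  have lip: "(exp (\<integral>s. r s x \<partial>lborel))-lipschitz_on ((\<lambda>u. G u x) ` {..t}) exp"
    by (rule lipschitz_on_exp) (auto intro: G_le[OF x])
  have D: "\<bar>D u\<bar> \<le> (\<integral>w. \<bar>damped_flow B t x w\<bar> \<partial>lborel)" for u
    unfolding D_def set_lebesgue_integral_def
    by (rule integral_abs_bound_integral)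
       (use int integrable_mult_indicator[OF _ int, of "{..u}"] in \<open>auto simp: indicator_def\<close>)
  show "absolutely_continuous_on {..t} (\<lambda>u. exp (G u x) * (c - D u))"
  proof (rule absolutely_continuous_on_mult)
    show "absolutely_continuous_on {..t} (\<lambda>u. exp (G u x))"
      by (rule absolutely_continuous_on_lipschitz_compose[OF absolutely_continuous_on_G[OF x] lip])
    have "absolutely_continuous_on {..t} D"
      unfolding D_def by (rule absolutely_continuous_on_indefinite_integral[OF int])
    then show "absolutely_continuous_on {..t} (\<lambda>u. c - D u)"
      by (rule absolutely_continuous_on_lipschitz_compose[where C = 1])
         (auto intro!: lipschitz_onI simp: dist_real_def)
    show "bounded ((\<lambda>u. exp (G u x)) ` {..t})"
      by (rule boundedI[of _ "exp (\<integral>s. r s x \<partial>lborel)"]) (auto intro: G_le[OF x])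
    show "bounded ((\<lambda>u. c - D u) ` {..t})"
    proof (rule boundedI, clarsimp)
      fix u show "\<bar>c - D u\<bar> \<le> \<bar>c\<bar> + (\<integral>w. \<bar>damped_flow B t x w\<bar> \<partial>lborel)"
        using D[of u] by linarith
    qed
  qed
  show "exp (G u x) * (c - D u) = enn2real (S B t u x)" if "u \<in> {..t}" for u
    using S_eq_Duhamel[OF B x, of u t] that by (simp add: c_def D_def)
qed

lemma tendsto_S:
  assumes B: "B \<in> sets X" and x: "x \<in> space X"
  shows "((\<lambda>u. enn2real (S B t u x)) \<longlongrightarrow> indicator B x) (at_left t)"
proof -
  have "continuous_on {..t} (\<lambda>u. enn2real (S B t u x))"
    by (rule absolutely_continuous_on_imp_continuous_on[OF absolutely_continuous_on_S[OF B x]])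
       (simp add: is_interval_ic)
  then have "((\<lambda>u. enn2real (S B t u x)) \<longlongrightarrow> enn2real (S B t t x)) (at t within {..t})"
    by (simp add: continuous_on_def)
  then have "((\<lambda>u. enn2real (S B t u x)) \<longlongrightarrow> enn2real (S B t t x)) (at_left t)"
    by (rule tendsto_within_subset) auto
  also have "enn2real (S B t t x) = indicator B x"
    using S_eq_Duhamel[OF B x order_refl] by (simp add: exp_minus)
  finally show ?thesis .
qed

text \<open>Product rule for Duhamel's formula at almost every \<open>u\<close>: differentiating
  \<open>exp (G u x)\<close> gives the rate term, and in the other term this factor cancels the
  damping.\<close>

lemma DERIV_S:
  assumes B: "B \<in> sets X" and x: "x \<in> space X"
  shows "AE u in lborel. u \<in> {T..<t} \<longrightarrow> ((\<lambda>u. enn2real (S B t u x)) has_real_derivative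
    r u x * enn2real (S B t u x) - flow B t x u) (at u within {T..<t})"
  using DERIV_G[OF x] AE_has_real_derivative_indefinite_integral[OF integrable_damped_flow[OF B x, of t]]
proof eventually_elim
  fix u
  define c where "c = indicator B x * exp (- G t x) + (LBINT w:{..t}. damped_flow B t x w)"
  define D where "D u = (LBINT w:{..u}. damped_flow B t x w)" for u
  assume dG: "((\<lambda>u. G u x) has_real_derivative r u x) (at u)"
    and "((\<lambda>u. LBINT w:{..u}. damped_flow B t x w) has_real_derivative damped_flow B t x u) (at u)"
  then have dD: "(D has_real_derivative damped_flow B t x u) (at u)" unfolding D_def by simp
  have S: "enn2real (S B t u x) = exp (G u x) * (c - D u)" if "u \<le> t" for u
    using S_eq_Duhamel[OF B x that] by (simp add: c_def D_def)
  have deq: "r u x * (exp (G u x) * (c - D u)) - flow B t x u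
      = exp (G u x) * r u x * (c - D u) + exp (G u x) * (0 - damped_flow B t x u)"
    by (simp add: damped_flow_def exp_minus field_simps)
  have "((\<lambda>u. exp (G u x) * (c - D u)) has_real_derivative
      r u x * (exp (G u x) * (c - D u)) - flow B t x u) (at u)"
    unfolding deq by (auto intro!: derivative_eq_intros dG dD)
  then have *: "((\<lambda>u. exp (G u x) * (c - D u)) has_real_derivative
      r u x * (exp (G u x) * (c - D u)) - flow B t x u) (at u within {T..<t})"
    by (rule has_field_derivative_at_within)
  show "u \<in> {T..<t} \<longrightarrow> ((\<lambda>u. enn2real (S B t u x)) has_real_derivative
    r u x * enn2real (S B t u x) - flow B t x u) (at u within {T..<t})"
  proof
    assume u: "u \<in> {T..<t}"
    show "((\<lambda>u. enn2real (S B t u x)) has_real_derivative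
      r u x * enn2real (S B t u x) - flow B t x u) (at u within {T..<t})"
      \<comment> \<open>Duhamel's formula is available only up to \<open>t\<close>, so the
        derivative is transferred within \<open>{T..<t}\<close>; the radius 1 is arbitrary.\<close>
      using u S[of u] S by (auto intro!: has_field_derivative_transform_within[OF *, of 1])
  qed
qed

text \<open>Conversely, the integrating factor turns a solution of the backward equation into a decreasing function
  of \<open>u\<close>, whose decrements are recovered from its derivative by absolute continuity.\<close>

theorem S_le_solution:
  fixes p :: "real \<Rightarrow> 'a \<Rightarrow> real"
  assumes B: "B \<in> sets X"
    and p_meas: "(\<lambda>(u, x). p u x) \<in> borel_measurable (borel \<Otimes>\<^sub>M X)"
    and p_nonneg: "\<And>u x. 0 \<le> p u x"
    and lim: "\<And>x. x \<in> space X \<Longrightarrow> ((\<lambda>u. p u x) \<longlongrightarrow> indicator B x) (at_left t)"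
    and ac: "\<And>x. x \<in> space X \<Longrightarrow> absolutely_continuous_on {T..<t} (\<lambda>u. p u x)"
    and deriv: "\<And>x. x \<in> space X \<Longrightarrow> AE u in lborel. u \<in> {T..<t} \<longrightarrow>
      integrable (K u x) (p u) \<and>
      ((\<lambda>u. p u x) has_real_derivative r u x * p u x - (\<integral>y. p u y \<partial>K u x)) (at u within {T..<t})"
    and u: "u \<in> {T..<t}" and x: "x \<in> space X"
  shows "S B t u x \<le> ennreal (p u x)"
proof (rule S_le_supersolution[OF B _ u x, where p = "\<lambda>u x. ennreal (p u x)"])
  fix u x assume u: "u \<in> {T..<t}" and x [measurable]: "x \<in> space X"
  note [measurable] = p_meas
  define \<phi> where "\<phi> w = (\<integral>\<^sup>+y. ennreal (p w y) \<partial>K w x)" for w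
  have \<phi>_meas [measurable]: "\<phi> \<in> borel_measurable borel" unfolding \<phi>_def[abs_def] by measurable
  \<comment> \<open>The fundamental theorem requires a compact interval, but \<open>p\<close> is
    controlled only before \<open>t\<close>; hence the stop at some \<open>b < t\<close>.\<close>
  have step: "(\<integral>\<^sup>+w\<in>{u..b}. ennreal (E x u w) * \<phi> w \<partial>lborel) + ennreal (E x u b * p b x) \<le> ennreal (p u x)"
    if b: "u \<le> b" "b < t" for b
  proof -
    \<comment> \<open>Wherever the backward equation holds, the inflow is finite, so
      \<open>enn2real\<close> loses nothing almost everywhere.\<close>
    define k where "k w = E x u w * enn2real (\<phi> w)" for w
    have sub: "{u..b} \<subseteq> {T..<t}" using u b by auto
    have acp: "absolutely_continuous_on {u..b} (\<lambda>v. p v x)"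
      by (rule absolutely_continuous_on_subset[OF ac[OF x] sub])
    have "continuous_on {u..b} (\<lambda>v. p v x)"
      by (rule absolutely_continuous_on_imp_continuous_on[OF acp]) (simp add: is_interval_cc)
    then have bdd: "bounded ((\<lambda>v. p v x) ` {u..b})"
      by (intro compact_imp_bounded compact_continuous_image) auto
    have ach: "absolutely_continuous_on {u..b} (\<lambda>v. E x u v * p v x)"
      by (rule absolutely_continuous_on_mult[OF absolutely_continuous_on_E[OF x] acp E_bounded bdd])
    have ae: "AE v in lborel. v \<in> {u..b} \<longrightarrow>
        ennreal (E x u v) * \<phi> v = ennreal (k v) \<and>
        ((\<lambda>v. E x u v * p v x) has_real_derivative - k v) (at v within {u..b})"
      using DERIV_G[OF x] deriv[OF x]
    proof eventually_elim
      fix v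
      assume dG: "((\<lambda>u. G u x) has_real_derivative r v x) (at v)"
        and dp: "v \<in> {T..<t} \<longrightarrow> integrable (K v x) (p v) \<and>
          ((\<lambda>u. p u x) has_real_derivative r v x * p v x - (\<integral>y. p v y \<partial>K v x)) (at v within {T..<t})"
      show "v \<in> {u..b} \<longrightarrow> ennreal (E x u v) * \<phi> v = ennreal (k v) \<and>
        ((\<lambda>v. E x u v * p v x) has_real_derivative - k v) (at v within {u..b})"
      proof (intro impI conjI)
        assume v: "v \<in> {u..b}"
        then have int: "integrable (K v x) (p v)"
          and d: "((\<lambda>u. p u x) has_real_derivative r v x * p v x - (\<integral>y. p v y \<partial>K v x)) (at v within {u..b})"
          using dp sub by (auto intro: has_field_derivative_subset)
        have \<phi>: "\<phi> v = ennreal (\<integral>y. p v y \<partial>K v x)"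
          unfolding \<phi>_def by (rule nn_integral_eq_integral[OF int]) (simp add: p_nonneg)
        have Ip: "0 \<le> (\<integral>y. p v y \<partial>K v x)" by (simp add: p_nonneg)
        show "ennreal (E x u v) * \<phi> v = ennreal (k v)"
          using Ip by (simp add: k_def \<phi> ennreal_mult E_pos less_imp_le)
        have dE: "((\<lambda>v. E x u v) has_real_derivative - (E x u v * r v x)) (at v within {u..b})"
          unfolding E_def by (auto intro!: derivative_eq_intros has_field_derivative_at_within[OF dG])
        show "((\<lambda>v. E x u v * p v x) has_real_derivative - k v) (at v within {u..b})"
          by (rule DERIV_cong[OF DERIV_mult[OF dE d]]) (simp add: k_def \<phi> Ip algebra_simps)
      qed
    qed
    have "(\<integral>\<^sup>+w\<in>{u..b}. ennreal (E x u w) * \<phi> w \<partial>lborel) = (\<integral>\<^sup>+w\<in>{u..b}. ennreal (k w) \<partial>lborel)"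
      using ae by (intro nn_integral_cong_AE) (auto elim!: eventually_mono simp: indicator_def)
    also have ae': "AE v in lborel. v \<in> {u..b} \<longrightarrow>
        ((\<lambda>v. E x u v * p v x) has_real_derivative - k v) (at v within {u..b})"
      using ae by (auto elim!: eventually_mono)
    have k: "0 \<le> k w" for w by (simp add: k_def E_pos less_imp_le)
    note ftc = absolutely_continuous_on_decreasing_nn_integral[OF ach b(1) k ae']
    note ftc(1)
    finally have "(\<integral>\<^sup>+w\<in>{u..b}. ennreal (E x u w) * \<phi> w \<partial>lborel) = ennreal (p u x - E x u b * p b x)"
      by (simp add: E_def)
    moreover have "E x u b * p b x \<le> p u x" using ftc(2) by (simp add: E_def)
    ultimately show ?thesis by (simp add: p_nonneg E_pos less_imp_le flip: ennreal_plus)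
  qed
  \<comment> \<open>A sequence that starts at \<open>u\<close> and increases to \<open>t\<close>
    without reaching it: monotone convergence handles the integral, and the left limit handles the
    boundary term.\<close>
  define b where "b n = t - (t - u) / real (Suc n)" for n
  have b: "u \<le> b n" "b n < t" for n
    using u by (auto simp: b_def field_simps intro: mult_right_mono)
  have "(\<lambda>n. t - (t - u) * inverse (real (Suc n))) \<longlonglongrightarrow> t - (t - u) * 0"
    by (intro tendsto_diff tendsto_mult tendsto_const LIMSEQ_inverse_real_of_nat)
  then have b_lim: "b \<longlonglongrightarrow> t"
    unfolding b_def[abs_def] by (simp add: divide_inverse)
  have b_left: "filterlim b (at_left t) sequentially"
    using b_lim b(2) by (auto simp: filterlim_at less_imp_neq)
  have inc: "b m \<le> b n" if "m \<le> n" for m n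
    using that u by (auto simp: b_def intro!: divide_left_mono)
  have "(\<lambda>n. (\<integral>\<^sup>+w\<in>{u..b n}. ennreal (E x u w) * \<phi> w \<partial>lborel))
      \<longlonglongrightarrow> (\<integral>\<^sup>+w\<in>{u..<t}. ennreal (E x u w) * \<phi> w \<partial>lborel)"
  proof (rule nn_integral_LIMSEQ)
    show "incseq (\<lambda>n w. ennreal (E x u w) * \<phi> w * indicator {u..b n} w)"
      using inc by (auto simp: incseq_def le_fun_def indicator_def intro: order_trans)
    show "(\<lambda>n. ennreal (E x u w) * \<phi> w * indicator {u..b n} w)
        \<longlonglongrightarrow> ennreal (E x u w) * \<phi> w * indicator {u..<t} w" for w
    proof (rule tendsto_eventually)
      show "\<forall>\<^sub>F n in sequentially. ennreal (E x u w) * \<phi> w * indicator {u..b n} w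
          = ennreal (E x u w) * \<phi> w * indicator {u..<t} w"
      proof (cases "w < t")
        case True
        then have "\<forall>\<^sub>F n in sequentially. w < b n" by (rule order_tendstoD[OF b_lim])
        then show ?thesis by eventually_elim (use True in \<open>auto simp: indicator_def\<close>)
      next
        case False
        have "w \<notin> {u..b n}" for n using False b(2)[of n] by auto
        then show ?thesis using False by (simp add: indicator_def)
      qed
    qed
  qed measurable
  \<comment> \<open>The boundary condition on \<open>p\<close> enters here, together with the
    continuity of \<open>E\<close> at \<open>t\<close>.\<close>
  moreover have "(\<lambda>n. ennreal (E x u (b n) * p (b n) x)) \<longlonglongrightarrow> ennreal (E x u t * indicator B x)"
  proof (intro tendsto_ennrealI tendsto_mult)
    show "(\<lambda>n. p (b n) x) \<longlonglongrightarrow> indicator B x"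
      by (rule filterlim_compose[OF lim[OF x] b_left])
    have "continuous_on UNIV (\<lambda>w. E x u w)"
      by (rule absolutely_continuous_on_imp_continuous_on[OF absolutely_continuous_on_E[OF x]]) simp
    then show "(\<lambda>n. E x u (b n)) \<longlonglongrightarrow> E x u t"
      by (rule continuous_on_tendsto_compose[OF _ b_lim]) auto
  qed
  ultimately have "(\<lambda>n. (\<integral>\<^sup>+w\<in>{u..b n}. ennreal (E x u w) * \<phi> w \<partial>lborel) + ennreal (E x u (b n) * p (b n) x))
      \<longlonglongrightarrow> (\<integral>\<^sup>+w\<in>{u..<t}. ennreal (E x u w) * \<phi> w \<partial>lborel) + ennreal (E x u t * indicator B x)"
    by (rule tendsto_add)
  then have "(\<integral>\<^sup>+w\<in>{u..<t}. ennreal (E x u w) * \<phi> w \<partial>lborel) + ennreal (E x u t * indicator B x) \<le> ennreal (p u x)"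
    by (rule LIMSEQ_le_const2) (use step[OF b] in auto)
  then show "indicator B x * ennreal (E x u t) +
      (\<integral>\<^sup>+w\<in>{u..<t}. ennreal (E x u w) * (\<integral>\<^sup>+y. ennreal (p w y) \<partial>K w x) \<partial>lborel) \<le> ennreal (p u x)"
    unfolding \<phi>_def by (cases "x \<in> B") (simp_all add: add.commute)
qed

end

section \<open>Q-functions on a standard Borel space\<close>

lemma signed_measure_Un:
  assumes \<mu>: "signed_measure X \<mu>" and "A \<in> sets X" "B \<in> sets X" "A \<inter> B = {}"
  shows "\<mu> (A \<union> B) = \<mu> A + \<mu> B"
proof -
  have "disjoint_family (binaryset A B)"
    using \<open>A \<inter> B = {}\<close> by (auto simp: disjoint_family_on_def binaryset_def)
  moreover have "range (binaryset A B) \<subseteq> sets X" using assms by (auto simp: range_binaryset_eq)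
  ultimately have "(\<lambda>i. \<mu> (binaryset A B i)) sums \<mu> (A \<union> B)"
    using \<mu> unfolding signed_measure_def by (metis UN_binaryset_eq)
  moreover have "(\<lambda>i. \<mu> (binaryset A B i)) sums (\<mu> A + \<mu> B)"
    using \<mu> by (intro binaryset_sums) (simp add: signed_measure_def)
  ultimately show ?thesis by (rule sums_unique2)
qed

lemma signed_measure_Diff:
  assumes \<mu>: "signed_measure X \<mu>" and [measurable]: "A \<in> sets X" "B \<in> sets X"
  shows "\<mu> (A - B) = \<mu> A - \<mu> (A \<inter> B)"
proof -
  have "\<mu> ((A - B) \<union> (A \<inter> B)) = \<mu> (A - B) + \<mu> (A \<inter> B)"
    by (rule signed_measure_Un[OF \<mu>]) auto
  moreover have "(A - B) \<union> (A \<inter> B) = A" by auto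
  ultimately show ?thesis by simp
qed

lemma measure_space_add_compl:
  assumes M: "measure_space \<Omega> M \<mu>" and A: "A \<in> M"
  shows "\<mu> A + \<mu> (\<Omega> - A) = \<mu> \<Omega>"
proof -
  interpret sigma_algebra \<Omega> M using M by (simp add: measure_space_def)
  let ?N = "measure_of \<Omega> M \<mu>"
  have em: "emeasure ?N B = \<mu> B" if "B \<in> M" for B
    using M that by (intro emeasure_measure_of_sigma) (auto simp: measure_space_def)
  have "emeasure ?N A + emeasure ?N (\<Omega> - A) = emeasure ?N (A \<union> (\<Omega> - A))"
    using A by (intro plus_emeasure) (auto simp: sets_measure_of_eq)
  moreover have "A \<union> (\<Omega> - A) = \<Omega>" using A sets_into_space by auto
  ultimately show ?thesis using em[OF A] em[OF top] em[OF compl_sets[OF A]] by simp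
qed

section \<open>Separating points by countably many measurable sets\<close>

text \<open>For \<open>x\<close> in the space, this is the atom containing \<open>x\<close> of the
  finite algebra generated by the first \<open>n\<close> sets.\<close>

definition cell :: "'a measure \<Rightarrow> (nat \<Rightarrow> 'a set) \<Rightarrow> nat \<Rightarrow> 'a \<Rightarrow> 'a set" where
  "cell X U n x = {y \<in> space X. \<forall>i<n. y \<in> U i \<longleftrightarrow> x \<in> U i}"

lemma cell_0 [simp]: "cell X U 0 x = space X"
  by (simp add: cell_def)

lemma cell_Suc:
  "cell X U (Suc n) x = (if x \<in> U n then cell X U n x \<inter> U n else cell X U n x - U n)"
  by (auto simp: cell_def less_Suc_eq)

lemma sets_cell [measurable]:
  assumes [measurable]: "\<And>n. U n \<in> sets X"
  shows "cell X U n x \<in> sets X"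
  by (induction n) (auto simp: cell_Suc)

text \<open>A countable base of a metrizable space separates points, so the atoms shrink to single
  points.\<close>

lemma standard_borel_separating:
  assumes "standard_borel X"
  obtains U :: "nat \<Rightarrow> 'a set" where "\<And>n. U n \<in> sets X"
    "\<And>x. x \<in> space X \<Longrightarrow> (\<Inter>n. cell X U n x) = {x}"
proof -
  obtain T where T: "completely_metrizable_space T" "second_countable T" "topspace T = space X"
    "sets X = sigma_sets (topspace T) {U. openin T U}"
    using assms unfolding standard_borel_def by blast
  obtain \<B> where \<B>: "countable \<B>" "\<And>V. V \<in> \<B> \<Longrightarrow> openin T V"
    "\<And>V x. openin T V \<Longrightarrow> x \<in> V \<Longrightarrow> \<exists>W\<in>\<B>. x \<in> W \<and> W \<subseteq> V"
    using T(2) unfolding second_countable_def by metis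
  \<comment> \<open>The empty set is added so that the base can be enumerated even if it is
    empty.\<close>
  define U where "U = from_nat_into (insert {} \<B>)"
  have range: "range U = insert {} \<B>" unfolding U_def using \<B>(1) by (intro range_from_nat_into) auto
  have "openin T (U n)" for n
    using range \<B>(2) by (metis insertE openin_empty rangeI)
  then have "U n \<in> sets X" for n using T(4) by auto
  moreover have "(\<Inter>n. cell X U n x) = {x}" if x: "x \<in> space X" for x
  proof -
    have "y = x" if y: "y \<in> (\<Inter>n. cell X U n x)" for y
    proof (rule ccontr)
      assume "y \<noteq> x"
      have y': "y \<in> topspace T" using y T(3) by (auto simp: cell_def)
      have "t1_space T"
        using T(1) completely_metrizable_imp_metrizable_space metrizable_imp_t1_space by blast
      then obtain V where "openin T V" "x \<in> V" "y \<notin> V"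
        unfolding t1_space_def using x y' T(3) \<open>y \<noteq> x\<close> by metis
      then obtain W where "W \<in> \<B>" "x \<in> W" "y \<notin> W" using \<B>(3) by blast
      then obtain n where "x \<in> U n" "y \<notin> U n" using range by (metis insertCI rangeE)
      \<comment> \<open>\<open>U n\<close> is first consulted by the cell with index
        \<open>Suc n\<close>.\<close>
      then show False using y by (auto simp: cell_def dest: spec[of _ "Suc n"])
    qed
    moreover have "x \<in> (\<Inter>n. cell X U n x)" using x by (simp add: cell_def)
    ultimately show ?thesis by blast
  qed
  ultimately show ?thesis using that by blast
qed

lemma standard_borel_singleton:
  assumes "standard_borel X" "x \<in> space X"
  shows "{x} \<in> sets X"
proof -
  obtain U :: "nat \<Rightarrow> 'a set" where U: "\<And>n. U n \<in> sets X" "(\<Inter>n. cell X U n x) = {x}"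
    using standard_borel_separating[OF assms(1)] assms(2) by metis
  have "(\<Inter>n. cell X U n x) \<in> sets X" using sets_cell[OF U(1)] by auto
  then show ?thesis by (simp add: U(2))
qed

section \<open>Stopping a Q-function at the terminal time\<close>

text \<open>One kernel for each terminal time, since rates need not be integrable up to
  \<open>T1\<close>. The null measure keeps the sigma-algebra of \<open>X\<close> at all other
  times.\<close>

definition stopped_kernel :: "'a measure \<Rightarrow> real \<Rightarrow> ('a \<Rightarrow> real \<Rightarrow> 'a set \<Rightarrow> real) \<Rightarrow> real \<Rightarrow> real \<Rightarrow> 'a \<Rightarrow> 'a measure"
  where "stopped_kernel X T0 q t w x = (if w \<in> {T0..t} then qplus X q x w else null_measure X)"

lemma time_setI: "T0 \<le> u \<Longrightarrow> u \<le> t \<Longrightarrow> ereal t < T1 \<Longrightarrow> u \<in> time_set T0 T1"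
  unfolding time_set_def by (auto intro: order_le_less_trans[of "ereal u" "ereal t"])

lemma sets_qplus [simp, measurable_cong]: "sets (qplus X q x t) = sets X"
  unfolding qplus_def by (rule sets.sets_measure_of_eq)

lemma space_qplus [simp]: "space (qplus X q x t) = space X"
  by (rule sets_eq_imp_space_eq) simp

context
  fixes X :: "'a measure" and T0 :: real and T1 :: ereal
    and q :: "'a \<Rightarrow> real \<Rightarrow> 'a set \<Rightarrow> real"
  assumes X: "standard_borel X"
    and q: "Q_function X T0 T1 q" and cons: "conservative X T0 T1 q"
    and int: "\<And>s x. T0 < s \<Longrightarrow> ereal s < T1 \<Longrightarrow> x \<in> space X \<Longrightarrow>
           (\<integral>\<^sup>+t\<in>{T0..s}. ennreal (rate q x t) \<partial>lborel) < \<infinity>"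
begin

lemma Q_signed: "x \<in> space X \<Longrightarrow> t \<in> time_set T0 T1 \<Longrightarrow> signed_measure X (q x t)"
  and Q_nonneg: "x \<in> space X \<Longrightarrow> t \<in> time_set T0 T1 \<Longrightarrow> B \<in> sets X \<Longrightarrow> 0 \<le> q x t (B - {x})"
  and Q_measurable: "B \<in> sets X \<Longrightarrow>
    (\<lambda>(x, t). q x t B) \<in> borel_measurable (X \<Otimes>\<^sub>M restrict_space borel (time_set T0 T1))"
  using q unfolding Q_function_def by blast+

text \<open>Deleting \<open>x\<close> from every member of a disjoint family keeps it disjoint, so
  countable additivity passes from the signed measure; nonnegativity then moves the series to
  \<open>ennreal\<close>.\<close>

lemma emeasure_qplus:
  assumes x: "x \<in> space X" and t: "t \<in> time_set T0 T1" and B: "B \<in> sets X"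
  shows "emeasure (qplus X q x t) B = ennreal (q x t (B - {x}))"
  unfolding qplus_def
proof (rule emeasure_measure_of_sigma[OF sets.sigma_algebra_axioms _ _ B])
  have [measurable]: "{x} \<in> sets X" by (rule standard_borel_singleton[OF X x])
  note sm = Q_signed[OF x t, unfolded signed_measure_def]
  show "positive (sets X) (\<lambda>B. ennreal (q x t (B - {x})))"
    using sm by (simp add: positive_def)
  show "countably_additive (sets X) (\<lambda>B. ennreal (q x t (B - {x})))"
  proof (rule countably_additiveI)
    fix A :: "nat \<Rightarrow> 'a set" assume A: "range A \<subseteq> sets X" "disjoint_family A"
    have "range (\<lambda>i. A i - {x}) \<subseteq> sets X" "disjoint_family (\<lambda>i. A i - {x})"
      using A by (auto simp: disjoint_family_on_def)
    then have "(\<lambda>i. q x t (A i - {x})) sums q x t (\<Union>i. A i - {x})"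
      using sm by blast
    moreover have "(\<Union>i. A i - {x}) = (\<Union>i. A i) - {x}" by auto
    ultimately show "(\<Sum>i. ennreal (q x t (A i - {x}))) = ennreal (q x t (\<Union> (range A) - {x}))"
      using A Q_nonneg[OF x t] by (intro suminf_ennreal_eq) auto
  qed
qed

text \<open>Conservativity makes the mass removed at \<open>x\<close> equal to the total jump mass,
  which is what \<open>jump_kernel\<close> uses as its rate.\<close>

lemma rate_eq:
  assumes x: "x \<in> space X" and t: "t \<in> time_set T0 T1"
  shows "rate q x t = q x t (space X - {x})"
proof -
  have [measurable]: "{x} \<in> sets X" by (rule standard_borel_singleton[OF X x])
  have "q x t (space X - {x}) = q x t (space X) - q x t (space X \<inter> {x})"
    by (rule signed_measure_Diff[OF Q_signed[OF x t]]) auto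
  moreover have "q x t (space X) = 0" using cons x t by (simp add: conservative_def)
  moreover have "space X \<inter> {x} = {x}" using x by auto
  ultimately show ?thesis by (simp add: rate_def)
qed

lemma rate_nonneg: "x \<in> space X \<Longrightarrow> t \<in> time_set T0 T1 \<Longrightarrow> 0 \<le> rate q x t"
  using Q_nonneg[of x t "space X"] by (simp add: rate_eq)

text \<open>The set \<open>B - {x}\<close> depends on \<open>x\<close>; it is the increasing limit of the sets \<open>B - cell X U n x\<close>, each of
  which takes only finitely many values as \<open>x\<close> varies.\<close>

lemma measurable_emeasure_qplus:
  assumes B: "B \<in> sets X"
  shows "(\<lambda>(x, t). emeasure (qplus X q x t) B) \<in> borel_measurable (X \<Otimes>\<^sub>M restrict_space borel (time_set T0 T1))"
    (is "_ \<in> borel_measurable ?M")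
proof -
  obtain U :: "nat \<Rightarrow> 'a set" where U [measurable]: "\<And>n. U n \<in> sets X"
    and cell: "\<And>x. x \<in> space X \<Longrightarrow> (\<Inter>n. cell X U n x) = {x}"
    using standard_borel_separating[OF X] by metis
  \<comment> \<open>The set \<open>A\<close> is generalised because one more sample set replaces it
    by \<open>A \<inter> U n\<close> or \<open>A - U n\<close>, according to whether
    \<open>x\<close> lies in \<open>U n\<close>.\<close>
  have cell_meas: "(\<lambda>(x, t). q x t (A \<inter> cell X U n x)) \<in> borel_measurable ?M" if "A \<in> sets X" for A n
    using that
  proof (induction n arbitrary: A)
    case 0
    then show ?case using Q_measurable[OF 0] sets.sets_into_space[OF 0] by (simp add: Int_absorb2)
  next
    case (Suc n)
    note [measurable] = Suc.prems
    have [measurable]: "(\<lambda>(x, t). q x t (A \<inter> U n \<inter> cell X U n x)) \<in> borel_measurable ?M"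
      "(\<lambda>(x, t). q x t ((A - U n) \<inter> cell X U n x)) \<in> borel_measurable ?M"
      by (rule Suc.IH; measurable)+
    have "A \<inter> cell X U (Suc n) x = (if x \<in> U n then A \<inter> U n \<inter> cell X U n x else (A - U n) \<inter> cell X U n x)" for x
      by (auto simp: cell_Suc)
    then have "(\<lambda>(x, t). q x t (A \<inter> cell X U (Suc n) x)) = (\<lambda>z. if fst z \<in> U n
        then (\<lambda>(x, t). q x t (A \<inter> U n \<inter> cell X U n x)) z else (\<lambda>(x, t). q x t ((A - U n) \<inter> cell X U n x)) z)"
      by (auto simp: fun_eq_iff)
    also have "\<dots> \<in> borel_measurable ?M" by measurable
    finally show ?case .
  qed
  have diff_meas: "(\<lambda>z. ennreal (q (fst z) (snd z) B - q (fst z) (snd z) (B \<inter> cell X U n (fst z)))) \<in> borel_measurable ?M" for n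
    using Q_measurable[OF B] cell_meas[OF B, of n] by (simp add: case_prod_beta)
  have "(\<lambda>z. SUP n. ennreal (q (fst z) (snd z) B - q (fst z) (snd z) (B \<inter> cell X U n (fst z)))) \<in> borel_measurable ?M"
    using diff_meas by (intro borel_measurable_SUP) auto
  also have "?this \<longleftrightarrow> ?thesis"
  proof (rule measurable_cong)
    fix z assume "z \<in> space ?M"
    then obtain x t where z: "z = (x, t)" and x: "x \<in> space X" and t: "t \<in> time_set T0 T1"
      by (auto simp: space_pair_measure space_restrict_space)
    have B': "B - {x} \<in> sets X" using B standard_borel_singleton[OF X x] by auto
    have xc: "x \<in> cell X U n x" for n using x by (simp add: cell_def)
    \<comment> \<open>\<open>x\<close> lies in each of its cells, so \<open>B - cell X U n x\<close>
      already omits \<open>x\<close> and the signed measure agrees with the jump measure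
      there.\<close>
    have em: "ennreal (q x t B - q x t (B \<inter> cell X U n x)) = emeasure (qplus X q x t) (B - cell X U n x)" for n
    proof -
      have "B - cell X U n x - {x} = B - cell X U n x" using xc by auto
      then show ?thesis
        using B sets_cell[OF U] by (simp add: emeasure_qplus[OF x t] signed_measure_Diff[OF Q_signed[OF x t]])
    qed
    have "(SUP n. emeasure (qplus X q x t) (B - cell X U n x)) = emeasure (qplus X q x t) (\<Union>n. B - cell X U n x)"
      using B sets_cell[OF U] by (intro SUP_emeasure_incseq) (auto simp: incseq_def cell_def)
    also have "(\<Union>n. B - cell X U n x) = B - {x}" using cell[OF x] by blast
    also have "emeasure (qplus X q x t) (B - {x}) = emeasure (qplus X q x t) B"
      using B B' by (simp add: emeasure_qplus[OF x t])
    finally show "(SUP n. ennreal (q (fst z) (snd z) B - q (fst z) (snd z) (B \<inter> cell X U n (fst z))))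
        = (case z of (x, t) \<Rightarrow> emeasure (qplus X q x t) B)"
      by (simp add: z em)
  qed
  finally show ?thesis .
qed

lemma jump_kernel_stopped:
  assumes t: "T0 < t" "ereal t < T1"
  shows "jump_kernel X (stopped_kernel X T0 q t)"
proof
  have time: "w \<in> time_set T0 T1" if "w \<in> {T0..t}" for w
    using that t by (auto intro: time_setI)
  show "sets (stopped_kernel X T0 q t w x) = sets X" for w x by (simp add: stopped_kernel_def)
  show "emeasure (stopped_kernel X T0 q t w x) (space X) < \<infinity>" if "x \<in> space X" for w x
    using time[of w] emeasure_qplus[OF that] by (auto simp: stopped_kernel_def)
  show "(\<integral>\<^sup>+w. emeasure (stopped_kernel X T0 q t w x) (space X) \<partial>lborel) < \<infinity>" if x: "x \<in> space X" for x
  proof -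
    have "emeasure (stopped_kernel X T0 q t w x) (space X) = ennreal (rate q x w) * indicator {T0..t} w" for w
      using time[of w] emeasure_qplus[OF x] rate_eq[OF x] by (auto simp: stopped_kernel_def indicator_def)
    then show ?thesis using int[OF t x] by simp
  qed
  show "(\<lambda>(w, x). emeasure (stopped_kernel X T0 q t w x) A) \<in> borel_measurable (borel \<Otimes>\<^sub>M X)"
    if A: "A \<in> sets X" for A
  proof -
    \<comment> \<open>Measurability of \<open>q\<close> is given on admissible times only. Clipping
      makes the composition meaningful for all real times; the values it produces outside
      \<open>[T0, t]\<close> are discarded by the conditional.\<close>
    define clip where "clip w = max T0 (min t w)" for w
    have [measurable]: "clip \<in> borel \<rightarrow>\<^sub>M restrict_space borel (time_set T0 T1)"
      using t by (intro measurable_restrict_space2) (auto simp: clip_def[abs_def] intro!: time)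
    note measurable_emeasure_qplus[OF A, measurable]
    have "(\<lambda>z. if fst z \<in> {T0..t} then (\<lambda>(x, t). emeasure (qplus X q x t) A) (snd z, clip (fst z)) else 0)
        \<in> borel_measurable (borel \<Otimes>\<^sub>M X)"
      by measurable
    also have "(\<lambda>z. if fst z \<in> {T0..t} then (\<lambda>(x, t). emeasure (qplus X q x t) A) (snd z, clip (fst z)) else 0)
        = (\<lambda>(w, x). emeasure (stopped_kernel X T0 q t w x) A)"
      using A by (auto simp: fun_eq_iff stopped_kernel_def clip_def)
    finally show ?thesis .
  qed
qed

section \<open>Transfer of the results to \<open>Pbar\<close>\<close>

text \<open>All times visited by the recursion from \<open>u\<close> lie in \<open>[T0, t]\<close>,
  where stopping changes nothing. It remains to rewrite the exponentials through \<open>G\<close>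
  and to move them out of the inner integral.\<close>

lemma Pbar_eq:
  assumes t: "T0 < t" "ereal t < T1" and u: "u \<in> {T0..<t}" and x: "x \<in> space X" and B: "B \<in> sets X"
  shows "Pbar X q (u, x, t, B) = enn2real (jump_kernel.S X (stopped_kernel X T0 q t) B t u x)"
proof -
  interpret jump_kernel X "stopped_kernel X T0 q t" by (rule jump_kernel_stopped[OF t])
  have time: "w \<in> time_set T0 T1" if "w \<in> {T0..t}" for w
    using that t by (auto intro: time_setI)
  have K: "stopped_kernel X T0 q t w x = qplus X q x w" if "w \<in> {T0..t}" for w x
    using that by (simp add: stopped_kernel_def)
  have rate: "r w x = rate q x w" if "w \<in> {T0..t}" "x \<in> space X" for w x
    using that time[of w] rate_nonneg
    by (simp add: r_def K measure_def emeasure_qplus rate_eq)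
  have E: "exp (- (LBINT s:{u..w}. rate q x s)) = E x u w"
    if "T0 \<le> u" "u \<le> w" "w \<le> t" "x \<in> space X" for u w x
  proof -
    have "(LBINT s:{u..w}. rate q x s) = (LBINT s:{u..w}. r s x)"
      using that by (intro set_lebesgue_integral_cong) (auto simp: rate)
    also have "\<dots> = (LBINT s:{u<..w}. r s x)"
      by (rule set_integral_interval_eq[OF integrable_r[OF that(4)]]) auto
    also have "\<dots> = G w x - G u x"
      unfolding G_def by (rule set_integral_diff_atMost[OF integrable_r[OF that(4)] that(2), symmetric])
    finally show ?thesis by (simp add: E_def)
  qed
  have "Pbar_term X q n u x t B = F B t n u x" for n
    using u x
  proof (induction n arbitrary: u x)
    case (Suc n)
    have "(\<integral>\<^sup>+y. ennreal (exp (- (LBINT \<theta>:{u..w}. rate q x \<theta>))) * Pbar_term X q n w y t B \<partial>qplus X q x w)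
        = ennreal (E x u w) * (\<integral>\<^sup>+y. F B t n w y \<partial>stopped_kernel X T0 q t w x)" if w: "w \<in> {u..<t}" for w
    proof -
      have "(\<integral>\<^sup>+y. ennreal (exp (- (LBINT \<theta>:{u..w}. rate q x \<theta>))) * Pbar_term X q n w y t B \<partial>qplus X q x w)
          = (\<integral>\<^sup>+y. ennreal (E x u w) * F B t n w y \<partial>stopped_kernel X T0 q t w x)"
        using w Suc.prems by (subst K) (auto intro!: nn_integral_cong simp: E Suc.IH)
      also have "\<dots> = ennreal (E x u w) * (\<integral>\<^sup>+y. F B t n w y \<partial>stopped_kernel X T0 q t w x)"
        by (rule nn_integral_cmult) (rule measurable_F_K[OF B Suc.prems(2)])
      finally show ?thesis .
    qed
    then show ?case by (auto intro!: nn_integral_cong simp: indicator_def)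
  qed (use E in auto)
  then show ?thesis by (simp add: Pbar_def S_def)
qed

lemma S_Pbar:
  assumes t: "T0 < t" "ereal t < T1" and u: "u \<in> {T0..<t}" and x: "x \<in> space X" and B: "B \<in> sets X"
  shows "jump_kernel.S X (stopped_kernel X T0 q t) B t u x = ennreal (Pbar X q (u, x, t, B))"
    and "Pbar X q (u, x, t, B) \<le> 1"
proof -
  interpret jump_kernel X "stopped_kernel X T0 q t" by (rule jump_kernel_stopped[OF t])
  have 1: "S B t u x \<le> 1" using S_le_1[OF B x] u by simp
  then have "S B t u x < top" by (rule order_le_less_trans) simp
  then show "S B t u x = ennreal (Pbar X q (u, x, t, B))"
    unfolding Pbar_eq[OF assms] by simp
  then show "Pbar X q (u, x, t, B) \<le> 1" using 1 by (simp add: ennreal_le_1)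
qed

lemma Pbar_nonneg: "0 \<le> Pbar X q e"
  by (cases e) (simp add: Pbar_def)

lemma Pbar_familyP: "Pbar X q \<in> familyP X T0 T1"
  unfolding familyP_def
proof (safe)
  fix t B assume t: "T0 < t" "ereal t < T1" and B [measurable]: "B \<in> sets X"
  interpret jump_kernel X "stopped_kernel X T0 q t" by (rule jump_kernel_stopped[OF t])
  let ?M = "restrict_space borel {T0..<t} \<Otimes>\<^sub>M X"
  have [measurable]: "fst \<in> borel_measurable ?M"
    by (rule measurable_compose[OF measurable_fst measurable_restrict_space1]) simp
  have "(\<lambda>z. enn2real (S B t (fst z) (snd z))) \<in> borel_measurable ?M" by measurable
  also have "?this \<longleftrightarrow> (\<lambda>(u, x). Pbar X q (u, x, t, B)) \<in> borel_measurable ?M"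
    by (rule measurable_cong) (auto simp: space_pair_measure space_restrict_space Pbar_eq[OF t _ _ B])
  finally show "(\<lambda>(u, x). Pbar X q (u, x, t, B)) \<in> borel_measurable ?M" .
qed (rule Pbar_nonneg)

lemma Pbar_boundary: "boundary_property X T0 T1 (Pbar X q)"
  unfolding boundary_property_def
proof (intro allI impI conjI)
  fix t x B assume t: "T0 < t" "ereal t < T1" and x: "x \<in> space X" and B: "B \<in> sets X"
  interpret jump_kernel X "stopped_kernel X T0 q t" by (rule jump_kernel_stopped[OF t])
  have "\<forall>\<^sub>F u in at_left t. enn2real (S B t u x) = Pbar X q (u, x, t, B)"
    using eventually_at_left_real[OF t(1)] by eventually_elim (auto simp: Pbar_eq[OF t _ x B])
  with tendsto_S[OF B x] show "((\<lambda>u. Pbar X q (u, x, t, B)) \<longlongrightarrow> indicator B x) (at_left t)"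
    by (rule Lim_transform_eventually)
  have "absolutely_continuous_on {T0..<t} (\<lambda>u. enn2real (S B t u x))"
    by (rule absolutely_continuous_on_subset[OF absolutely_continuous_on_S[OF B x]]) auto
  then show "absolutely_continuous_on {T0..<t} (\<lambda>u. Pbar X q (u, x, t, B))"
    by (rule absolutely_continuous_on_cong) (simp add: Pbar_eq[OF t _ x B])
qed

lemma Pbar_backward: "backward_equation X T0 T1 q (Pbar X q)"
  unfolding backward_equation_def
proof (intro allI impI)
  fix t x B assume t: "T0 < t" "ereal t < T1" and x: "x \<in> space X" and B: "B \<in> sets X"
  interpret jump_kernel X "stopped_kernel X T0 q t" by (rule jump_kernel_stopped[OF t])
  show "AE u in lborel. u \<in> {T0..<t} \<longrightarrow>
      integrable (qplus X q x u) (\<lambda>y. Pbar X q (u, y, t, B)) \<and>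
      ((\<lambda>v. Pbar X q (v, x, t, B)) has_real_derivative
         rate q x u * Pbar X q (u, x, t, B) - (\<integral>y. Pbar X q (u, y, t, B) \<partial>qplus X q x u)) (at u within {T0..<t})"
    using DERIV_S[OF B x, of T0 t]
  proof eventually_elim
    fix u
    assume d: "u \<in> {T0..<t} \<longrightarrow> ((\<lambda>u. enn2real (S B t u x)) has_real_derivative
      r u x * enn2real (S B t u x) - flow B t x u) (at u within {T0..<t})"
    show "u \<in> {T0..<t} \<longrightarrow>
      integrable (qplus X q x u) (\<lambda>y. Pbar X q (u, y, t, B)) \<and>
      ((\<lambda>v. Pbar X q (v, x, t, B)) has_real_derivative
         rate q x u * Pbar X q (u, x, t, B) - (\<integral>y. Pbar X q (u, y, t, B) \<partial>qplus X q x u)) (at u within {T0..<t})"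
    proof (intro impI conjI)
      assume u: "u \<in> {T0..<t}"
      then have ut: "u < t" by simp
      have time: "u \<in> time_set T0 T1"
        using u t by (auto intro: time_setI[of _ _ t])
      have K: "stopped_kernel X T0 q t u x = qplus X q x u" using u by (simp add: stopped_kernel_def)
      have r: "r u x = rate q x u"
        by (simp add: r_def K measure_def emeasure_qplus[OF x time] rate_eq[OF x time, symmetric] rate_nonneg[OF x time])
      have eq: "enn2real (S B t u y) = Pbar X q (u, y, t, B)" if "y \<in> space X" for y
        using Pbar_eq[OF t u that B] by simp
      show "integrable (qplus X q x u) (\<lambda>y. Pbar X q (u, y, t, B))"
        using flow_eq(2)[OF B x ut] unfolding K
        by (subst (asm) Bochner_Integration.integrable_cong[OF refl, of _ _ "\<lambda>y. Pbar X q (u, y, t, B)"]) (simp_all add: eq)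
      have "flow B t x u = (\<integral>y. enn2real (S B t u y) \<partial>qplus X q x u)"
        using flow_eq(3)[OF B x ut] by (simp add: K)
      also have "\<dots> = (\<integral>y. Pbar X q (u, y, t, B) \<partial>qplus X q x u)"
        by (rule Bochner_Integration.integral_cong) (simp_all add: eq)
      finally have "((\<lambda>u. enn2real (S B t u x)) has_real_derivative
          rate q x u * Pbar X q (u, x, t, B) - (\<integral>y. Pbar X q (u, y, t, B) \<partial>qplus X q x u)) (at u within {T0..<t})"
        using d u by (simp add: r eq[OF x])
      then show "((\<lambda>v. Pbar X q (v, x, t, B)) has_real_derivative
         rate q x u * Pbar X q (u, x, t, B) - (\<integral>y. Pbar X q (u, y, t, B) \<partial>qplus X q x u)) (at u within {T0..<t})"
        by (rule has_field_derivative_transform_within[OF _ zero_less_one u]) (simp add: Pbar_eq[OF t _ x B])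
    qed
  qed
qed

lemma Pbar_le_solution:
  assumes P: "P \<in> familyP X T0 T1" "boundary_property X T0 T1 P" "backward_equation X T0 T1 q P"
    and t: "T0 < t" "ereal t < T1" and u: "u \<in> {T0..<t}" and x: "x \<in> space X" and B: "B \<in> sets X"
  shows "Pbar X q (u, x, t, B) \<le> P (u, x, t, B)"
proof -
  interpret jump_kernel X "stopped_kernel X T0 q t" by (rule jump_kernel_stopped[OF t])
  \<comment> \<open>Extension by zero turns the properties on \<open>[T0, t[\<close> into the global
    measurability and nonnegativity required by \<open>S_le_solution\<close>.\<close>
  define p where "p u x = (if u \<in> {T0..<t} \<and> x \<in> space X then P (u, x, t, B) else 0)" for u x
  have p: "p u x = P (u, x, t, B)" if "u \<in> {T0..<t}" "x \<in> space X" for u x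
    using that by (simp add: p_def)
  have P_nonneg: "0 \<le> P (u, x, t, B)" if "u \<in> {T0..<t}" "x \<in> space X" for u x
    using P(1) that t B by (auto simp: familyP_def domP_def)
  have "S B t u x \<le> ennreal (p u x)"
  proof (rule S_le_solution[OF B _ _ _ _ _ u x])
    show "(\<lambda>(u, x). p u x) \<in> borel_measurable (borel \<Otimes>\<^sub>M X)"
    proof -
      define clip where "clip u = (if u \<in> {T0..<t} then u else T0)" for u
      have [measurable]: "clip \<in> borel \<rightarrow>\<^sub>M restrict_space borel {T0..<t}"
        using t by (intro measurable_restrict_space2) (auto simp: clip_def[abs_def])
      have [measurable]: "(\<lambda>(u, x). P (u, x, t, B)) \<in> borel_measurable (restrict_space borel {T0..<t} \<Otimes>\<^sub>M X)"
        using P(1) t B by (simp add: familyP_def)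
      have "(\<lambda>z. if fst z \<in> {T0..<t} then (\<lambda>(u, x). P (u, x, t, B)) (clip (fst z), snd z) else 0)
          \<in> borel_measurable (borel \<Otimes>\<^sub>M X)"
        by measurable
      also have "?this \<longleftrightarrow> ?thesis"
        by (rule measurable_cong) (auto simp: space_pair_measure p_def clip_def)
      finally show ?thesis .
    qed
    show "0 \<le> p u x" for u x using P_nonneg by (auto simp: p_def)
  next
    fix x assume x: "x \<in> space X"
    have "((\<lambda>u. P (u, x, t, B)) \<longlongrightarrow> indicator B x) (at_left t)"
      using P(2) t x B unfolding boundary_property_def by blast
    moreover have "\<forall>\<^sub>F u in at_left t. P (u, x, t, B) = p u x"
      using eventually_at_left_real[OF t(1)] by eventually_elim (simp add: p x)
    ultimately show "((\<lambda>u. p u x) \<longlongrightarrow> indicator B x) (at_left t)"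
      by (rule Lim_transform_eventually)
    have "absolutely_continuous_on {T0..<t} (\<lambda>u. P (u, x, t, B))"
      using P(2) t x B unfolding boundary_property_def by blast
    then show "absolutely_continuous_on {T0..<t} (\<lambda>u. p u x)"
      by (rule absolutely_continuous_on_cong) (simp add: p x)
    have "AE u in lborel. u \<in> {T0..<t} \<longrightarrow>
           integrable (qplus X q x u) (\<lambda>y. P (u, y, t, B)) \<and>
           ((\<lambda>v. P (v, x, t, B)) has_real_derivative
              rate q x u * P (u, x, t, B) - (\<integral>y. P (u, y, t, B) \<partial>qplus X q x u))
             (at u within {T0..<t})"
      using P(3) t x B unfolding backward_equation_def by blast
    then show "AE u in lborel. u \<in> {T0..<t} \<longrightarrow>
      integrable (stopped_kernel X T0 q t u x) (p u) \<and>
      ((\<lambda>u. p u x) has_real_derivative r u x * p u x - (\<integral>y. p u y \<partial>stopped_kernel X T0 q t u x)) (at u within {T0..<t})"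
    proof (eventually_elim, intro impI conjI)
      fix u
      assume u: "u \<in> {T0..<t}"
        and *: "u \<in> {T0..<t} \<longrightarrow>
           integrable (qplus X q x u) (\<lambda>y. P (u, y, t, B)) \<and>
           ((\<lambda>v. P (v, x, t, B)) has_real_derivative
              rate q x u * P (u, x, t, B) - (\<integral>y. P (u, y, t, B) \<partial>qplus X q x u))
             (at u within {T0..<t})"
      have time: "u \<in> time_set T0 T1"
        using u t by (auto intro: time_setI[of _ _ t])
      have K: "stopped_kernel X T0 q t u x = qplus X q x u" using u by (simp add: stopped_kernel_def)
      have r: "r u x = rate q x u"
        by (simp add: r_def K measure_def emeasure_qplus[OF x time] rate_eq[OF x time, symmetric] rate_nonneg[OF x time])
      show "integrable (stopped_kernel X T0 q t u x) (p u)"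
        using * u unfolding K by (subst Bochner_Integration.integrable_cong[OF refl, of _ _ "\<lambda>y. P (u, y, t, B)"]) (simp_all add: p[OF u])
      have "(\<integral>y. p u y \<partial>qplus X q x u) = (\<integral>y. P (u, y, t, B) \<partial>qplus X q x u)"
        by (rule Bochner_Integration.integral_cong) (simp_all add: p[OF u])
      then have "((\<lambda>v. P (v, x, t, B)) has_real_derivative
          r u x * p u x - (\<integral>y. p u y \<partial>stopped_kernel X T0 q t u x)) (at u within {T0..<t})"
        using * u by (simp add: K r p x)
      then show "((\<lambda>u. p u x) has_real_derivative r u x * p u x - (\<integral>y. p u y \<partial>stopped_kernel X T0 q t u x)) (at u within {T0..<t})"
        by (rule has_field_derivative_transform_within[OF _ zero_less_one u]) (simp add: p x)
    qed
  qed
  then show ?thesis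
    using P_nonneg[OF u x] by (simp add: S_Pbar(1)[OF t u x B] p[OF u x])
qed

text \<open>Countable additivity is inherited from \<open>S\<close>; the value 0 at the empty set is
  checked term by term.\<close>

lemma Pbar_measure_valued: "measure_valued X T0 T1 (Pbar X q)"
  unfolding measure_valued_def measure_space_def
proof (intro allI impI conjI)
  fix t u x assume t: "T0 < t" "ereal t < T1" and u: "T0 \<le> u" "u < t" and x: "x \<in> space X"
  interpret jump_kernel X "stopped_kernel X T0 q t" by (rule jump_kernel_stopped[OF t])
  have S: "ennreal (Pbar X q (u, x, t, B)) = S B t u x" if "B \<in> sets X" for B
    using S_Pbar(1)[OF t _ x that] u by simp
  show "sigma_algebra (space X) (sets X)" by (rule sets.sigma_algebra_axioms)
  have "F {} t n u x = 0" for n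
    using x
  proof (induction n arbitrary: u x)
    case (Suc n)
    have "(\<integral>\<^sup>+y. F {} t n w y \<partial>stopped_kernel X T0 q t w x) = (\<integral>\<^sup>+y. 0 \<partial>stopped_kernel X T0 q t w x)" for w
      using Suc by (intro nn_integral_cong) (simp add: space_K)
    then show ?case by simp
  qed simp
  then show "positive (sets X) (\<lambda>B. ennreal (Pbar X q (u, x, t, B)))"
    unfolding positive_def by (simp add: S) (simp add: S_def)
  show "countably_additive (sets X) (\<lambda>B. ennreal (Pbar X q (u, x, t, B)))"
  proof (rule countably_additiveI)
    fix A :: "nat \<Rightarrow> 'a set"
    assume A: "range A \<subseteq> sets X" "disjoint_family A" "\<Union> (range A) \<in> sets X"
    then show "(\<Sum>i. ennreal (Pbar X q (u, x, t, A i))) = ennreal (Pbar X q (u, x, t, \<Union> (range A)))"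
      using S_UN[of A x t u] x by (simp add: S range_subsetD)
  qed
qed

end

section \<open>Minimality, and uniqueness under regularity\<close>

theorem theorem2:
  fixes X :: "'a measure" and T0 :: real and T1 :: ereal
    and q :: "'a \<Rightarrow> real \<Rightarrow> 'a set \<Rightarrow> real"
  assumes "standard_borel X"
    and "0 \<le> T0" and "ereal T0 < T1"
    and "Q_function X T0 T1 q" and "conservative X T0 T1 q"
    and "\<And>s x. T0 < s \<Longrightarrow> ereal s < T1 \<Longrightarrow> x \<in> space X \<Longrightarrow>
           (\<integral>\<^sup>+t\<in>{T0..s}. ennreal (rate q x t) \<partial>lborel) < \<infinity>"
  shows "minimal_on (domP X T0 T1)
           {P \<in> familyP X T0 T1. boundary_property X T0 T1 P \<and> backward_equation X T0 T1 q P}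
           (Pbar X q) \<and>
         (regular X T0 T1 (Pbar X q) \<longrightarrow>
          unique_on (domP X T0 T1)
            {P \<in> familyP X T0 T1. boundary_property X T0 T1 P \<and> backward_equation X T0 T1 q P \<and>
               measure_valued X T0 T1 P \<and> (\<forall>e\<in>domP X T0 T1. P e \<in> {0..1})}
            (Pbar X q))"
proof (intro conjI impI)
  note A = assms(1,4,5) assms(6)
  note sol = Pbar_familyP[OF A] Pbar_boundary[OF A] Pbar_backward[OF A]
  show "minimal_on (domP X T0 T1)
           {P \<in> familyP X T0 T1. boundary_property X T0 T1 P \<and> backward_equation X T0 T1 q P} (Pbar X q)"
    unfolding minimal_on_def domP_def using sol Pbar_le_solution[OF A] by auto
  assume reg: "regular X T0 T1 (Pbar X q)"
  show "unique_on (domP X T0 T1)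
            {P \<in> familyP X T0 T1. boundary_property X T0 T1 P \<and> backward_equation X T0 T1 q P \<and>
               measure_valued X T0 T1 P \<and> (\<forall>e\<in>domP X T0 T1. P e \<in> {0..1})} (Pbar X q)"
    unfolding unique_on_def
  proof (intro conjI ballI)
    have "Pbar X q e \<in> {0..1}" if "e \<in> domP X T0 T1" for e
      using that S_Pbar(2)[OF A] Pbar_nonneg[OF A] by (auto simp: domP_def)
    then show "Pbar X q \<in> {P \<in> familyP X T0 T1. boundary_property X T0 T1 P \<and> backward_equation X T0 T1 q P \<and>
               measure_valued X T0 T1 P \<and> (\<forall>e\<in>domP X T0 T1. P e \<in> {0..1})}"
      using sol Pbar_measure_valued[OF A] by simp
  next
    fix P e
    assume P: "P \<in> {P \<in> familyP X T0 T1. boundary_property X T0 T1 P \<and> backward_equation X T0 T1 q P \<and>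
               measure_valued X T0 T1 P \<and> (\<forall>e\<in>domP X T0 T1. P e \<in> {0..1})}"
      and "e \<in> domP X T0 T1"
    then obtain u x t B where e: "e = (u, x, t, B)" and t: "T0 < t" "ereal t < T1"
      and u: "T0 \<le> u" "u < t" and x: "x \<in> space X" and B: "B \<in> sets X"
      by (auto simp: domP_def)
    have dom: "(u, x, t, C) \<in> domP X T0 T1" if "C \<in> sets X" for C
      using that t u x by (simp add: domP_def)
    have split: "Q (u, x, t, B) + Q (u, x, t, space X - B) = Q (u, x, t, space X)"
      if "measure_valued X T0 T1 Q" and Q: "\<And>e. e \<in> domP X T0 T1 \<Longrightarrow> 0 \<le> Q e" for Q
    proof -
      have "measure_space (space X) (sets X) (\<lambda>B. ennreal (Q (u, x, t, B)))"
        using that(1) t u x unfolding measure_valued_def by blast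
      from measure_space_add_compl[OF this B] show ?thesis
        using Q[OF dom[OF B]] Q[OF dom[of "space X - B"]] Q[OF dom[of "space X"]] B
        by (simp flip: ennreal_plus)
    qed
    have "P (u, x, t, B) + P (u, x, t, space X - B) = P (u, x, t, space X)"
      using P by (intro split) auto
    also have "\<dots> \<le> 1" using P dom[of "space X"] by auto
    also have "1 = Pbar X q (u, x, t, space X)"
      using reg t u x time_setI[of T0 u t T1] by (simp add: regular_def)
    also have "\<dots> = Pbar X q (u, x, t, B) + Pbar X q (u, x, t, space X - B)"
      by (rule split[symmetric, OF Pbar_measure_valued[OF A] Pbar_nonneg[OF A]])
    finally have "P (u, x, t, B) + P (u, x, t, space X - B)
        \<le> Pbar X q (u, x, t, B) + Pbar X q (u, x, t, space X - B)" .
    moreover have "Pbar X q (u, x, t, C) \<le> P (u, x, t, C)" if "C \<in> sets X" for C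
      using P t u x that by (intro Pbar_le_solution[OF A]) auto
    from this[OF B] this[of "space X - B"]
    have "Pbar X q (u, x, t, B) \<le> P (u, x, t, B)"
      "Pbar X q (u, x, t, space X - B) \<le> P (u, x, t, space X - B)" using B by auto
    \<comment> \<open>The two summands are ordered one way and their sums the other way, so both
      inequalities are equalities.\<close>
    ultimately show "P e = Pbar X q e" unfolding e by linarith
  qed
qed

end
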